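(* Let $n,k$ be integers with $n>2$ and $1<k<n$, and let $s=\left\lfloor \frac{n-2}{k-1}\right\rfloor$. Then the clique number of the 1-skeleton of the polytope $DCMST_{n,k}$ satisfies $$\omega(DCMST_{n,k}) \geq 2^{\left(\sqrt{\left\lfloor \frac{s-1}{2}\right\rfloor}-9\right)/2}.$$
   Context: $K_n$ is the complete graph on an $n$-element vertex set $V$ with edge set $E$, $|E|=d=n(n-1)/2$. For a subgraph $t$ of $K_n$, $x(t)\in\mathbb{R}^d$ (coordinates indexed by $E$) is its characteristic vector: coordinate $1$ for edges of $t$, $0$ otherwise. $DCMST_{n,k}$ is the convex hull of the characteristic vectors of all spanning trees of $K_n$ in which no vertex has degree larger than $k$. The 1-skeleton of a polytope is the graph whose vertices are the polytope's vertices and whose edges are its 1-dimensional faces; $\omega(\cdot)$ denotes its clique number (size of a largest clique). *)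

theory Defs
  imports "HOL-Analysis.Analysis"
begin

definition Kn_edges :: "nat \<Rightarrow> nat set set" where
  "Kn_edges n = {{u, v} | u v. u < n \<and> v < n \<and> u \<noteq> v}"

definition graph_connected :: "nat \<Rightarrow> nat set set \<Rightarrow> bool" where
  "graph_connected n T \<longleftrightarrow>
     (\<forall>u v. u < n \<longrightarrow> v < n \<longrightarrow> (\<lambda>a b. {a, b} \<in> T)\<^sup>*\<^sup>* u v)"

definition spanning_tree :: "nat \<Rightarrow> nat set set \<Rightarrow> bool" where
  "spanning_tree n T \<longleftrightarrow> T \<subseteq> Kn_edges n \<and> graph_connected n T \<and>
     (\<forall>e\<in>T. \<not> graph_connected n (T - {e}))"

definition vdegree :: "nat set set \<Rightarrow> nat \<Rightarrow> nat" where
  "vdegree T v = card {e \<in> T. v \<in> e}"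

text \<open>Characteristic vector in R^E, the coordinates being identified with the
  edges of K_n through a bijection idx from E onto the finite index type 'd.\<close>
definition charvec :: "('d::finite \<Rightarrow> nat set) \<Rightarrow> nat set set \<Rightarrow> real ^ 'd" where
  "charvec eoc T = (\<chi> j. if eoc j \<in> T then 1 else 0)"

definition DCMST :: "nat \<Rightarrow> nat \<Rightarrow> (nat set \<Rightarrow> 'd::finite) \<Rightarrow> (real ^ 'd) set" where
  "DCMST n k idx = convex hull
     {charvec (inv_into (Kn_edges n) idx) T | T. spanning_tree n T \<and> (\<forall>v < n. vdegree T v \<le> k)}"

definition skel_vertices :: "('a::real_vector) set \<Rightarrow> 'a set" where
  "skel_vertices P = {x. x extreme_point_of P}"

definition skel_adjacent :: "('a::real_vector) set \<Rightarrow> 'a \<Rightarrow> 'a \<Rightarrow> bool" where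
  "skel_adjacent P x y \<longleftrightarrow> x \<in> skel_vertices P \<and> y \<in> skel_vertices P \<and> x \<noteq> y \<and>
     closed_segment x y face_of P"

definition skel_clique :: "('a::real_vector) set \<Rightarrow> 'a set \<Rightarrow> bool" where
  "skel_clique P C \<longleftrightarrow> C \<subseteq> skel_vertices P \<and>
     (\<forall>x\<in>C. \<forall>y\<in>C. x \<noteq> y \<longrightarrow> skel_adjacent P x y)"

definition skel_clique_number :: "('a::real_vector) set \<Rightarrow> nat" where
  "skel_clique_number P = Max {card C | C. skel_clique P C}"

end

theory Submission
  imports Defs
begin

text \<open>
  Two trees are adjacent in the skeleton if no third tree contains their intersection and is contained
  in their union. Replacing nodes by edges and saturating degrees with pendant leaves, it suffices to
  construct many directed Hamiltonian paths on N nodes such that the union of any two of them contains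
  no third one.

  For \<open>x \<in> {0,1}^r\<close> take a path that passes, for every pair i < j, through a block in which three
  pairwise crossing exchanges can be made: one governed by \<open>x_i\<close>, one by \<open>x_j\<close> and one by a further
  bit \<open>d_ij\<close>. The block stays connected iff \<open>d_ij = x_i xor x_j\<close>. All exchanges governed by \<open>x_i\<close> form a
  single alternating cycle, so every Hamiltonian path in the union of the paths of x and y comes from
  some z with \<open>z_i \<in> {x_i, y_i}\<close> and \<open>d_ij \<in> {x_i xor x_j, y_i xor y_j}\<close>. If x and y differ in both
  i and j, then \<open>z_i xor z_j = x_i xor x_j\<close>; hence z = x or z = y. This gives \<open>2^r\<close> pairwise
  adjacent vertices with \<open>N \<le> 4r^2 - 5r + 1\<close>.
\<close>

section \<open>Adjacency in the degree-constrained spanning tree polytope\<close>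

definition dc_tree :: "nat \<Rightarrow> nat \<Rightarrow> nat set set \<Rightarrow> bool" where
  "dc_tree n k T \<longleftrightarrow> spanning_tree n T \<and> (\<forall>v<n. vdegree T v \<le> k)"

lemma DCMST_eq_hull_dc_trees:
  "DCMST n k idx = convex hull (charvec (inv_into (Kn_edges n) idx) ` {T. dc_tree n k T})"
  unfolding DCMST_def dc_tree_def by (rule arg_cong[where f = "(hull) convex"]) auto

lemma finite_Kn_edges [simp]: "finite (Kn_edges n)"
  by (rule finite_subset[of _ "Pow {..<n}"]) (auto simp: Kn_edges_def)

lemma dc_tree_subset: "dc_tree n k T \<Longrightarrow> T \<subseteq> Kn_edges n"
  by (simp add: dc_tree_def spanning_tree_def)

lemma finite_dc_trees [simp]: "finite {T. dc_tree n k T}"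
  by (rule finite_subset[of _ "Pow (Kn_edges n)"]) (use dc_tree_subset in auto)

lemma charvec_eq_iff:
  fixes idx :: "nat set \<Rightarrow> 'd::finite"
  assumes "bij_betw idx (Kn_edges n) UNIV" "S \<subseteq> Kn_edges n" "T \<subseteq> Kn_edges n"
  shows "charvec (inv_into (Kn_edges n) idx) S = charvec (inv_into (Kn_edges n) idx) T \<longleftrightarrow> S = T"
proof
  assume eq: "charvec (inv_into (Kn_edges n) idx) S = charvec (inv_into (Kn_edges n) idx) T"
  have "e \<in> S \<longleftrightarrow> e \<in> T" if "e \<in> Kn_edges n" for e
  proof -
    have "inv_into (Kn_edges n) idx (idx e) = e"
      using assms(1) that by (simp add: bij_betw_inv_into_left)
    moreover have "charvec (inv_into (Kn_edges n) idx) S $ idx e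
        = charvec (inv_into (Kn_edges n) idx) T $ idx e"
      using eq by simp
    ultimately show ?thesis by (simp add: charvec_def split: if_splits)
  qed
  then show "S = T" using assms by blast
qed simp

text \<open>The linear functional with weight 1 on T1 \<inter> T2, 0 on the symmetric difference and -1 elsewhere
  is maximal exactly at the trees T with T1 \<inter> T2 \<subseteq> T \<subseteq> T1 \<union> T2.\<close>

lemma segment_face_of_DCMST:
  fixes idx :: "nat set \<Rightarrow> 'd::finite"
  assumes bij: "bij_betw idx (Kn_edges n) UNIV"
    and T: "dc_tree n k T1" "dc_tree n k T2"
    and between: "\<And>T. dc_tree n k T \<Longrightarrow> T1 \<inter> T2 \<subseteq> T \<Longrightarrow> T \<subseteq> T1 \<union> T2 \<Longrightarrow> T = T1 \<or> T = T2"
  shows "closed_segment (charvec (inv_into (Kn_edges n) idx) T1)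
           (charvec (inv_into (Kn_edges n) idx) T2) face_of DCMST n k idx"
proof -
  define eoc where "eoc = inv_into (Kn_edges n) idx"
  have eoc: "\<exists>j. eoc j = e" if "e \<in> Kn_edges n" for e
    using bij that unfolding eoc_def by (metis bij_betw_inv_into_left)
  define c :: "real ^ 'd" where
    "c = (\<chi> j. if eoc j \<in> T1 \<inter> T2 then 1 else if eoc j \<in> T1 \<union> T2 then 0 else -1)"
  define b :: real where "b = (\<Sum>j\<in>UNIV. if eoc j \<in> T1 \<inter> T2 then 1 else 0)"
  define W where "W = charvec eoc ` {T. dc_tree n k T}"
  have term_le: "c $ j * charvec eoc T $ j \<le> (if eoc j \<in> T1 \<inter> T2 then 1 else 0)" for j T
    by (auto simp: c_def charvec_def)
  have inner: "c \<bullet> charvec eoc T = (\<Sum>j\<in>UNIV. c $ j * charvec eoc T $ j)" for T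
    by (simp add: inner_vec_def)
  have le: "c \<bullet> charvec eoc T \<le> b" for T
    unfolding inner b_def by (rule sum_mono) (rule term_le)
  have eq: "c \<bullet> charvec eoc T = b \<longleftrightarrow> T = T1 \<or> T = T2" if dcT: "dc_tree n k T" for T
  proof
    assume "c \<bullet> charvec eoc T = b"
    \<comment> \<open>The bound holds coordinate by coordinate, so equality of the sums forces
      equality in every coordinate.\<close>
    then have *: "c $ j * charvec eoc T $ j = (if eoc j \<in> T1 \<inter> T2 then 1 else 0)" for j
      unfolding inner b_def
      by (intro sum_mono_inv[where I = UNIV and f = "\<lambda>j. c $ j * charvec eoc T $ j"])
        (use term_le in auto)
    have "T1 \<inter> T2 \<subseteq> T"
    proof
      fix e assume e: "e \<in> T1 \<inter> T2"
      then obtain j where "eoc j = e" using eoc T(1) dc_tree_subset by blast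
      with *[of j] e show "e \<in> T" by (simp add: charvec_def split: if_splits)
    qed
    moreover have "T \<subseteq> T1 \<union> T2"
    proof
      fix e assume e: "e \<in> T"
      then obtain j where "eoc j = e" using eoc dcT dc_tree_subset by blast
      with *[of j] e show "e \<in> T1 \<union> T2" by (auto simp: charvec_def c_def split: if_splits)
    qed
    ultimately show "T = T1 \<or> T = T2" using between dcT by blast
  next
    assume "T = T1 \<or> T = T2"
    then show "c \<bullet> charvec eoc T = b"
      unfolding inner b_def by (intro sum.cong) (auto simp: c_def charvec_def)
  qed
  have hull_le: "c \<bullet> x \<le> b" if "x \<in> convex hull W" for x
  proof -
    have "convex hull W \<subseteq> {x. c \<bullet> x \<le> b}"
      by (rule hull_minimal) (use le convex_halfspace_le in \<open>auto simp: W_def\<close>)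
    with that show ?thesis by auto
  qed
  define F where "F = convex hull W \<inter> {x. c \<bullet> x = b}"
  have face: "F face_of convex hull W"
    unfolding F_def using hull_le by (intro face_of_Int_supporting_hyperplane_le) auto
  \<comment> \<open>A face of the hull of a finite set is the hull of some of its points, so only
    the generators on the hyperplane matter, and these are the vectors of \<open>T1\<close> and
    \<open>T2\<close>.\<close>
  have "compact W" unfolding W_def by (intro finite_imp_compact) simp
  then obtain W' where W': "W' \<subseteq> W" "F = convex hull W'"
    using face_of_convex_hull_subset[OF _ face] by blast
  have "W' \<subseteq> {charvec eoc T1, charvec eoc T2}"
  proof
    fix x assume "x \<in> W'"
    then have "x \<in> F" "x \<in> W" using W' by (auto intro: hull_inc)
    then show "x \<in> {charvec eoc T1, charvec eoc T2}"
      using eq by (auto simp: F_def W_def)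
  qed
  then have "F \<subseteq> closed_segment (charvec eoc T1) (charvec eoc T2)"
    unfolding W'(2) segment_convex_hull by (rule hull_mono)
  moreover have "closed_segment (charvec eoc T1) (charvec eoc T2) \<subseteq> F"
  proof -
    have "charvec eoc T1 \<in> F" "charvec eoc T2 \<in> F"
      using T eq by (auto simp: F_def W_def intro: hull_inc)
    moreover have "convex F" using W'(2) by simp
    ultimately show ?thesis by (simp add: closed_segment_subset)
  qed
  ultimately show ?thesis using face unfolding DCMST_eq_hull_dc_trees W_def eoc_def by simp
qed

text \<open>The degenerate segment \<open>T1 = T2\<close>: the only tree between \<open>T\<close>
  and itself is \<open>T\<close>.\<close>

lemma charvec_extreme_point_of_DCMST:
  fixes idx :: "nat set \<Rightarrow> 'd::finite"
  assumes "bij_betw idx (Kn_edges n) UNIV" "dc_tree n k T"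
  shows "charvec (inv_into (Kn_edges n) idx) T extreme_point_of DCMST n k idx"
proof -
  have "closed_segment (charvec (inv_into (Kn_edges n) idx) T)
      (charvec (inv_into (Kn_edges n) idx) T) face_of DCMST n k idx"
    using assms by (intro segment_face_of_DCMST) auto
  then show ?thesis by (simp add: face_of_singleton)
qed

text \<open>\<open>Max\<close> is meaningful because the extreme points lie among the finitely many
  generators, so there are only finitely many cliques.\<close>

lemma card_le_skel_clique_number:
  assumes "skel_clique (DCMST n k idx) C"
  shows "card C \<le> skel_clique_number (DCMST n k idx)"
proof -
  let ?P = "DCMST n k idx"
  have fin: "finite (skel_vertices ?P)"
    unfolding skel_vertices_def DCMST_eq_hull_dc_trees
    by (rule finite_subset[OF _ finite_imageI[OF finite_dc_trees]])
      (auto dest!: extreme_point_of_convex_hull)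
  have "{card C | C. skel_clique ?P C} \<subseteq> card ` Pow (skel_vertices ?P)"
    by (auto simp: skel_clique_def)
  then have "finite {card C | C. skel_clique ?P C}"
    by (rule finite_subset) (simp add: fin)
  then show ?thesis
    unfolding skel_clique_number_def by (rule Max_ge) (use assms in blast)
qed

text \<open>From here on the polytope disappears: what remains is to find a large family of trees
  closed under betweenness.\<close>

lemma card_le_skel_clique_numberI:
  fixes idx :: "nat set \<Rightarrow> 'd::finite"
  assumes bij: "bij_betw idx (Kn_edges n) UNIV"
    and dc: "\<And>T. T \<in> \<F> \<Longrightarrow> dc_tree n k T"
    and between: "\<And>T1 T2 T. T1 \<in> \<F> \<Longrightarrow> T2 \<in> \<F> \<Longrightarrow> dc_tree n k T \<Longrightarrow>
      T1 \<inter> T2 \<subseteq> T \<Longrightarrow> T \<subseteq> T1 \<union> T2 \<Longrightarrow> T = T1 \<or> T = T2"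
  shows "card \<F> \<le> skel_clique_number (DCMST n k idx)"
proof -
  let ?c = "charvec (inv_into (Kn_edges n) idx)"
  have "skel_clique (DCMST n k idx) (?c ` \<F>)"
    unfolding skel_clique_def skel_adjacent_def skel_vertices_def
  proof (intro conjI ballI impI; clarsimp)
    fix T1 T2 assume "T1 \<in> \<F>" "T2 \<in> \<F>"
    then show "closed_segment (?c T1) (?c T2) face_of DCMST n k idx"
      by (intro segment_face_of_DCMST[OF bij dc dc] between)
  qed (intro charvec_extreme_point_of_DCMST[OF bij dc], assumption)+
  moreover have "inj_on ?c \<F>"
    by (rule inj_onI) (simp add: charvec_eq_iff[OF bij] dc[THEN dc_tree_subset])
  ultimately show ?thesis
    using card_le_skel_clique_number[of n k idx "?c ` \<F>"] by (simp add: card_image)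
qed

section \<open>Spanning trees by counting edges\<close>

text \<open>Each vertex other than 0 is charged with the edge to its parent in a breadth-first tree.\<close>

lemma graph_connected_card_ge:
  assumes "graph_connected n T" "finite T"
  shows "n \<le> card T + 1"
proof (cases "n = 0")
  case False
  define R where "R = (\<lambda>a b. {a, b} \<in> T)"
  define d where "d v = (LEAST m. (R ^^ m) 0 v)" for v
  have ex: "\<exists>p. d p < d v \<and> {p, v} \<in> T" if v: "v \<in> {1..<n}" for v
  proof -
    have "R\<^sup>*\<^sup>* 0 v"
      using assms(1) v False by (simp add: graph_connected_def R_def)
    then obtain m where "(R ^^ m) 0 v" by (auto simp: rtranclp_power)
    then have dv: "(R ^^ d v) 0 v" unfolding d_def by (rule LeastI)
    with v obtain m where m: "d v = Suc m" by (cases "d v") auto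
    with dv obtain p where p: "(R ^^ m) 0 p" "R p v" by auto
    from p(1) have "d p \<le> m" unfolding d_def by (rule Least_le)
    with p(2) m show ?thesis unfolding R_def by (metis le_imp_less_Suc)
  qed
  then obtain par where par: "\<And>v. v \<in> {1..<n} \<Longrightarrow> d (par v) < d v \<and> {par v, v} \<in> T"
    by metis
  \<comment> \<open>Two vertices charged with the same edge would be parents of each other, and each
    would be nearer to 0 than the other.\<close>
  have "inj_on (\<lambda>v. {par v, v}) {1..<n}"
    by (rule inj_onI) (metis par doubleton_eq_iff less_asym)
  then have "card {1..<n} \<le> card T"
    by (rule card_inj_on_le) (use par assms(2) in auto)
  then show ?thesis by simp
qed simp

text \<open>A connected graph has at least n - 1 edges, so one with at most n - 1 edges cannot lose
  any.\<close>

lemma spanning_treeI: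
  assumes "T \<subseteq> Kn_edges n" "graph_connected n T" "card T < n"
  shows "spanning_tree n T"
  unfolding spanning_tree_def
proof (intro conjI ballI notI)
  fix e assume e: "e \<in> T" "graph_connected n (T - {e})"
  have "finite T" using assms(1) by (rule finite_subset) simp
  then have "card (T - {e}) < card T" using e(1) by (rule card_Diff1_less)
  with graph_connected_card_ge[OF e(2)] \<open>finite T\<close> assms(3) show False by simp
qed (use assms in auto)

lemma graph_connectedI:
  assumes "\<And>v. v < n \<Longrightarrow> (\<lambda>a b. {a, b} \<in> T)\<^sup>*\<^sup>* c v"
  shows "graph_connected n T"
  unfolding graph_connected_def
proof (intro allI impI)
  fix u v assume uv: "u < n" "v < n"
  have "symp (\<lambda>a b. {a, b} \<in> T)" by (auto simp: symp_def insert_commute)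
  then have "symp (\<lambda>a b. {a, b} \<in> T)\<^sup>*\<^sup>*" by (rule symp_rtranclp)
  then have "(\<lambda>a b. {a, b} \<in> T)\<^sup>*\<^sup>* u c" using assms[OF uv(1)] by (rule sympD)
  then show "(\<lambda>a b. {a, b} \<in> T)\<^sup>*\<^sup>* u v" using assms[OF uv(2)] by (rule rtranclp_trans)
qed

text \<open>Shows that the polytope has a vertex, which settles the bound when the exponent is not
  positive.\<close>

lemma dc_tree_path:
  assumes "1 < k" "0 < n"
  shows "dc_tree n k ((\<lambda>v. {v, Suc v}) ` {..<n - 1})" (is "dc_tree n k ?T")
  unfolding dc_tree_def
proof (intro conjI allI impI)
  have con: "v < n \<longrightarrow> (\<lambda>a b. {a, b} \<in> ?T)\<^sup>*\<^sup>* 0 v" for v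
  proof (induction v)
    case (Suc v)
    show ?case
    proof
      assume "Suc v < n"
      then have "{v, Suc v} \<in> ?T" by auto
      with Suc \<open>Suc v < n\<close> show "(\<lambda>a b. {a, b} \<in> ?T)\<^sup>*\<^sup>* 0 (Suc v)"
        by (simp add: rtranclp.rtrancl_into_rtrancl)
    qed
  qed simp
  show "spanning_tree n ?T"
  proof (rule spanning_treeI)
    show "?T \<subseteq> Kn_edges n"
    proof
      fix e assume "e \<in> ?T"
      then obtain v where "v < n - 1" "e = {v, Suc v}" by auto
      then show "e \<in> Kn_edges n"
        unfolding Kn_edges_def by (intro CollectI exI[of _ v] exI[of _ "Suc v"]) auto
    qed
    show "graph_connected n ?T" using con by (intro graph_connectedI) blast
    have "card ?T \<le> n - 1" using card_image_le[of "{..<n - 1}"] by simp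
    then show "card ?T < n" using assms by simp
  qed
  fix v assume "v < n"
  have "{e \<in> ?T. v \<in> e} \<subseteq> {{v, Suc v}, {v - 1, v}}" by auto
  then have "vdegree ?T v \<le> card {{v, Suc v}, {v - 1, v}}"
    unfolding vdegree_def by (rule card_mono[rotated]) simp
  also have "\<dots> \<le> 2" by (simp add: card_insert_if)
  finally show "vdegree ?T v \<le> k" using assms by simp
qed

section \<open>From directed Hamiltonian paths to trees\<close>

text \<open>\<open>A\<close> is the arc set of a directed Hamiltonian path on \<open>V\<close> starting in \<open>src\<close>; connectedness is
  expressed by the absence of a proper subset of \<open>V\<close> containing \<open>src\<close> that no arc enters or leaves.\<close>

definition ham_arcs :: "'v set \<Rightarrow> 'v \<Rightarrow> 'v rel \<Rightarrow> bool" where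
  "ham_arcs V src A \<longleftrightarrow>
     A \<subseteq> V \<times> V \<and> (\<forall>(v, w)\<in>A. v \<noteq> w \<and> w \<noteq> src) \<and>
     single_valued A \<and> single_valued (A\<inverse>) \<and> card A + 1 = card V \<and>
     (\<forall>S. src \<in> S \<longrightarrow> (\<forall>(v, w)\<in>A. v \<in> S \<longleftrightarrow> w \<in> S) \<longrightarrow> V \<subseteq> S)"

lemma card_Un3_le: "card (A \<union> B \<union> C) \<le> card A + card B + card C"
  by (rule order_trans[OF card_Un_le]) (simp add: card_Un_le)

text \<open>A node v becomes the edge between its entrance \<open>inn v\<close> and its exit \<open>out v\<close>. Each of the
  2N core vertices carries k - 2 leaves, so a tree of maximal degree k has at most one arc edge at it.
  The leftover vertices form a chain hanging from the entrance of \<open>src\<close>, which no arc enters.\<close>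

locale node_embedding =
  fixes n k N :: nat and V :: "'v set" and enc :: "'v \<Rightarrow> nat" and src :: 'v
  assumes enc: "bij_betw enc V {..<N}"
    and src: "src \<in> V"
    and k: "2 \<le> k"
    and size: "2 * N * (k - 1) \<le> n"
begin

definition inn :: "'v \<Rightarrow> nat" where "inn v = 2 * enc v"
definition out :: "'v \<Rightarrow> nat" where "out v = 2 * enc v + 1"

definition core_end :: nat where "core_end = 2 * N * (k - 1)"

text \<open>The vertices from \<open>2 * N\<close> up to \<open>core_end\<close> are k - 2 further
  copies of the core, each hanging from its original, which is found by reduction mod
  \<open>2 * N\<close>. From \<open>core_end\<close> on, the leftover chain begins.\<close>

definition par :: "nat \<Rightarrow> nat" where
  "par u = (if u < core_end then u mod (2 * N)
     else if u = core_end then inn src else u - 1)"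

definition base :: "nat set set" where
  "base = (\<lambda>v. {inn v, out v}) ` V \<union> (\<lambda>u. {par u, u}) ` {2 * N..<n}"

definition tree :: "'v rel \<Rightarrow> nat set set" where
  "tree A = base \<union> (\<lambda>(v, w). {out v, inn w}) ` A"

lemma finite_V: "finite V" and card_V: "card V = N"
  using bij_betw_finite[OF enc] bij_betw_same_card[OF enc] by simp_all

lemma core_bound: "2 * N \<le> core_end" and core_end_le: "core_end \<le> n"
proof -
  have "2 * N * 1 \<le> 2 * N * (k - 1)" using k by (intro mult_left_mono) auto
  then show "2 * N \<le> core_end" "core_end \<le> n" using size by (simp_all only: core_end_def mult_1_right)
qed

lemma core_less: "v \<in> V \<Longrightarrow> inn v < 2 * N" "v \<in> V \<Longrightarrow> out v < 2 * N"
proof -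
  have "enc v < N" if "v \<in> V" using bij_betwE[OF enc] that by auto
  then show "v \<in> V \<Longrightarrow> inn v < 2 * N" "v \<in> V \<Longrightarrow> out v < 2 * N"
    by (simp_all add: inn_def out_def)
qed

lemma N_pos: "0 < N"
  using core_less(1)[OF src] by simp

lemma inn_neq_out [simp]: "inn v \<noteq> out w" "out w \<noteq> inn v"
  unfolding inn_def out_def by presburger+

lemma inn_eq_iff [simp]: "v \<in> V \<Longrightarrow> w \<in> V \<Longrightarrow> inn v = inn w \<longleftrightarrow> v = w"
  and out_eq_iff [simp]: "v \<in> V \<Longrightarrow> w \<in> V \<Longrightarrow> out v = out w \<longleftrightarrow> v = w"
  using inj_on_eq_iff[OF bij_betw_imp_inj_on[OF enc]] by (simp_all add: inn_def out_def)

lemma core_cases: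
  assumes "c < 2 * N"
  obtains v where "v \<in> V" "c = inn v" | v where "v \<in> V" "c = out v"
proof -
  have "c div 2 \<in> enc ` V" using enc assms by (auto simp: bij_betw_def)
  then obtain v where v: "v \<in> V" "c div 2 = enc v" by blast
  have "c = inn v \<or> c = out v" using v(2) unfolding inn_def out_def by presburger
  with v that show thesis by blast
qed

lemma par_less: "2 * N \<le> u \<Longrightarrow> par u < u"
  using core_less(1)[OF src] core_bound N_pos mod_less_divisor[of "2 * N" u]
  by (auto simp: par_def simp del: mod_less_divisor)

section \<open>The tree of an arc set\<close>

lemma tree_subset:
  assumes "A \<subseteq> V \<times> V"
  shows "tree A \<subseteq> Kn_edges n"
proof -
  have pair: "{a, b} \<in> Kn_edges n" if "a < n" "b < n" "a \<noteq> b" for a b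
    using that by (auto simp: Kn_edges_def)
  have "2 * N \<le> n" using core_bound core_end_le by simp
  then have "inn v < n" "out v < n" if "v \<in> V" for v
    using core_less[OF that] by simp_all
  moreover have "par u < n \<and> par u \<noteq> u" if "u \<in> {2 * N..<n}" for u
    using par_less[of u] that by auto
  ultimately show ?thesis
    using assms by (auto simp: tree_def base_def intro!: pair)
qed

lemma finite_tree: "A \<subseteq> V \<times> V \<Longrightarrow> finite (tree A)"
  by (rule finite_subset[OF tree_subset]) simp_all

lemma card_tree_le:
  assumes "A \<subseteq> V \<times> V"
  shows "card (tree A) \<le> (n - N) + card A"
proof -
  have fA: "finite A" using assms finite_V finite_subset by blast
  have "card (tree A) \<le> card ((\<lambda>v. {inn v, out v}) ` V) + card ((\<lambda>u. {par u, u}) ` {2 * N..<n})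
      + card ((\<lambda>(v, w). {out v, inn w}) ` A)"
    unfolding tree_def base_def by (rule card_Un3_le)
  also have "\<dots> \<le> card V + card {2 * N..<n} + card A"
    using finite_V fA by (intro add_mono card_image_le) auto
  also have "\<dots> = (n - N) + card A"
    using card_V core_bound core_end_le by simp
  finally show ?thesis .
qed

text \<open>An edge inside a node joins the two ends of a single node, and a hanging edge has an end
  outside the core, so neither can be mistaken for an arc edge.\<close>

lemma arc_edge_in_tree_iff:
  assumes "A \<subseteq> V \<times> V" "v \<in> V" "w \<in> V" "v \<noteq> w"
  shows "{out v, inn w} \<in> tree A \<longleftrightarrow> (v, w) \<in> A"
proof
  assume "{out v, inn w} \<in> tree A"
  then consider v' where "v' \<in> V" "{out v, inn w} = {inn v', out v'}"
    | u where "2 * N \<le> u" "{out v, inn w} = {par u, u}"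
    | v' w' where "(v', w') \<in> A" "{out v, inn w} = {out v', inn w'}"
    by (auto simp: tree_def base_def)
  then show "(v, w) \<in> A"
  proof cases
    case 1
    then show ?thesis using assms by (auto simp: doubleton_eq_iff)
  next
    case 2
    then have "u < 2 * N" using core_less(2)[of v] core_less(1)[of w] assms
      by (auto simp: doubleton_eq_iff)
    with 2 show ?thesis by simp
  next
    case 3
    then have "v' \<in> V" "w' \<in> V" using assms by auto
    with 3 show ?thesis using assms by (auto simp: doubleton_eq_iff)
  qed
qed (auto simp: tree_def)

lemma tree_inject:
  assumes "ham_arcs V src A" "ham_arcs V src A'" "tree A = tree A'"
  shows "A = A'"
proof -
  have "A \<subseteq> A'" if "ham_arcs V src A" "ham_arcs V src A'" "tree A = tree A'" for A A'
  proof
    fix p assume p: "p \<in> A"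
    obtain v w where vw: "p = (v, w)" by fastforce
    have "v \<in> V" "w \<in> V" "v \<noteq> w" "A \<subseteq> V \<times> V" "A' \<subseteq> V \<times> V"
      using that(1,2) p vw by (auto simp: ham_arcs_def)
    then show "p \<in> A'"
      using arc_edge_in_tree_iff[of A v w] arc_edge_in_tree_iff[of A' v w] that(3) p vw by simp
  qed
  from this[OF assms] this[OF assms(2,1) assms(3)[symmetric]] show ?thesis by (rule equalityI)
qed

section \<open>Leaves and the degree budget\<close>

definition leaves :: "nat \<Rightarrow> nat set" where
  "leaves c = (\<lambda>t. t * (2 * N) + c) ` {1..<k - 1}"

lemma card_leaves: "card (leaves c) = k - 2"
  unfolding leaves_def using N_pos by (subst card_image) (auto simp: inj_on_def)

lemma leaves_bound:
  assumes "u \<in> leaves c" "c < 2 * N"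
  shows "2 * N \<le> u" "u < core_end" "par u = c"
proof -
  obtain t where t: "1 \<le> t" "t < k - 1" "u = t * (2 * N) + c"
    using assms(1) by (auto simp: leaves_def)
  have "(t + 1) * (2 * N) \<le> (k - 1) * (2 * N)"
    using t by (intro mult_right_mono) auto
  then show u: "u < core_end" using t assms(2) by (simp add: core_end_def algebra_simps)
  have "1 * (2 * N) \<le> t * (2 * N)" using t by (intro mult_right_mono) auto
  then show "2 * N \<le> u" using t(3) by linarith
  show "par u = c" using u t assms(2) by (simp add: par_def)
qed

lemma par_eq_core:
  assumes "2 * N \<le> u" "par u = c" "c < 2 * N"
  shows "u \<in> leaves c \<or> u = core_end \<and> c = inn src"
proof (cases "u < core_end")
  case True
  then have "c = u mod (2 * N)" using assms by (simp add: par_def)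
  then have "u = (u div (2 * N)) * (2 * N) + c" using div_mult_mod_eq[of u "2 * N"] by simp
  moreover have "u div (2 * N) < k - 1"
    using True by (simp add: core_end_def less_mult_imp_div_less mult.commute)
  moreover have "1 \<le> u div (2 * N)"
    using assms(1) N_pos by (simp add: div_greater_zero_iff Suc_le_eq)
  ultimately show ?thesis unfolding leaves_def by (metis atLeastLessThan_iff image_eqI)
next
  case False
  then show ?thesis using assms core_bound by (auto simp: par_def split: if_splits)
qed

text \<open>The k - 2 leaves use up all but two of the permitted degree. One of the remaining two
  goes to the other end of the node, which leaves room for a single arc edge.\<close>

lemma card_core_neighbours_le:
  assumes T: "\<And>v. v < n \<Longrightarrow> vdegree T v \<le> k" "base \<subseteq> T" "finite T"
    and c: "c < 2 * N"
    and W: "finite W" "\<And>w. w \<in> W \<Longrightarrow> w < 2 * N \<and> {c, w} \<in> T"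
  shows "card W \<le> 2"
proof -
  have "(\<lambda>u. {c, u}) ` (leaves c \<union> W) \<subseteq> {e \<in> T. c \<in> e}"
  proof -
    have "{c, u} \<in> base" if "u \<in> leaves c" for u
    proof -
      have "u \<in> {2 * N..<n}" using leaves_bound[OF that c] core_end_le by auto
      moreover have "{c, u} = {par u, u}" using leaves_bound(3)[OF that c] by simp
      ultimately show ?thesis unfolding base_def by blast
    qed
    then show ?thesis using T(2) W(2) by auto
  qed
  then have "card ((\<lambda>u. {c, u}) ` (leaves c \<union> W)) \<le> vdegree T c"
    unfolding vdegree_def using T(3) by (intro card_mono) auto
  moreover have "inj_on (\<lambda>u. {c, u}) (leaves c \<union> W)"
    by (rule inj_onI) (auto simp: doubleton_eq_iff)
  moreover have "card (leaves c \<union> W) = k - 2 + card W"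
  proof -
    have "leaves c \<inter> W = {}" using leaves_bound(1)[OF _ c] W(2) by fastforce
    moreover have "finite (leaves c)" by (simp add: leaves_def)
    ultimately show ?thesis using W(1) by (simp add: card_Un_disjoint card_leaves)
  qed
  moreover have "vdegree T c \<le> k" using T(1) c core_bound core_end_le by simp
  ultimately show ?thesis using k by (simp add: card_image)
qed

lemma card_single_valued_Image_le: "single_valued R \<Longrightarrow> card (R `` {v}) \<le> 1"
proof (cases "R `` {v} = {}")
  case False
  assume "single_valued R"
  with False obtain w where "R `` {v} = {w}" by (auto simp: single_valued_def)
  then show ?thesis by simp
qed simp

text \<open>Besides its leaves and the other end of its node, a core vertex has at most one arc
  edge; the entrance of \<open>src\<close> has the chain in its place. A vertex outside the core has
  at most a parent and a child.\<close>

lemma vdegree_tree_le: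
  assumes A: "ham_arcs V src A" and c: "c < n"
  shows "vdegree (tree A) c \<le> k"
proof -
  have AV: "A \<subseteq> V \<times> V" and sv: "single_valued A" "single_valued (A\<inverse>)"
    and src': "A\<inverse> `` {src} = {}"
    using A by (auto simp: ham_arcs_def)
  have bound: "vdegree (tree A) c \<le> card X" if "{e \<in> tree A. c \<in> e} \<subseteq> (\<lambda>u. {c, u}) ` X" "finite X" for X
    unfolding vdegree_def
    using card_mono[OF finite_imageI[OF that(2)] that(1)] card_image_le[OF that(2), of "\<lambda>u. {c, u}"]
    by simp
  have fin: "finite (leaves c)" by (simp add: leaves_def)
  have fin_image: "finite (R `` {v})" if "R \<subseteq> V \<times> V" for R v
    using that by (intro finite_subset[OF _ finite_V]) auto
  show ?thesis
  proof (cases "c < 2 * N")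
    case False
    have "{e \<in> tree A. c \<in> e} \<subseteq> (\<lambda>u. {c, u}) ` {par c, c + 1}"
    proof
      fix e assume e: "e \<in> {e \<in> tree A. c \<in> e}"
      then have "e \<in> (\<lambda>u. {par u, u}) ` {2 * N..<n}"
        using False core_less AV by (auto simp: tree_def base_def)
      then obtain u where u: "e = {par u, u}" "2 * N \<le> u" by auto
      \<comment> \<open>Parents outside the core occur only in the chain, where the parent is the
        preceding number.\<close>
      have "u = c + 1" if "par u = c"
        using that False core_less(1)[OF src] N_pos mod_less_divisor[of "2 * N" u]
        by (auto simp: par_def split: if_splits)
      then show "e \<in> (\<lambda>u. {c, u}) ` {par c, c + 1}" using u e by auto
    qed
    then have "vdegree (tree A) c \<le> card {par c, c + 1}" by (rule bound) simp
    also have "\<dots> \<le> 2" by (simp add: card_insert_if)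
    finally show ?thesis using k by simp
  next
    case True
    have hung: "u \<in> leaves c \<or> u = core_end \<and> c = inn src"
      if "c \<in> {par u, u}" "2 * N \<le> u" for u
      using par_eq_core that True by auto
    have hung_edge: "{par u, u} = {c, u}" if "c \<in> {par u, u}" "2 * N \<le> u" for u
      using that True by auto
    from True show ?thesis
    proof (cases rule: core_cases)
      case (2 v)
      let ?X = "leaves c \<union> {inn v} \<union> inn ` (A `` {v})"
      have "{e \<in> tree A. c \<in> e} \<subseteq> (\<lambda>u. {c, u}) ` ?X"
      proof
        fix e assume e: "e \<in> {e \<in> tree A. c \<in> e}"
        then consider v' where "v' \<in> V" "e = {inn v', out v'}"
          | u where "2 * N \<le> u" "e = {par u, u}"
          | v' w' where "(v', w') \<in> A" "e = {out v', inn w'}"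
          by (auto simp: tree_def base_def)
        then show "e \<in> (\<lambda>u. {c, u}) ` ?X"
        proof cases
          case 1
          then show ?thesis using e 2 by auto
        next
          case (2 u)
          then show ?thesis using e hung[of u] hung_edge[of u] \<open>c = out v\<close> by auto
        next
          case 3
          then have "v' \<in> V" using AV by auto
          then show ?thesis using 3 e 2 by auto
        qed
      qed
      then have "vdegree (tree A) c \<le> card ?X"
        by (rule bound) (use fin fin_image[OF AV] in auto)
      also have "\<dots> \<le> card (leaves c) + card {inn v} + card (inn ` (A `` {v}))"
        by (rule card_Un3_le)
      also have "\<dots> \<le> (k - 2) + 1 + 1"
        using card_image_le[OF fin_image[OF AV], of inn v] card_single_valued_Image_le[OF sv(1), of v]
        by (simp add: card_leaves)
      finally show ?thesis using k by simp
    next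
      case (1 v)
      let ?X = "leaves c \<union> {out v} \<union> (if v = src then {core_end} else out ` (A\<inverse> `` {v}))"
      have AV': "A\<inverse> \<subseteq> V \<times> V" using AV by auto
      have "{e \<in> tree A. c \<in> e} \<subseteq> (\<lambda>u. {c, u}) ` ?X"
      proof
        fix e assume e: "e \<in> {e \<in> tree A. c \<in> e}"
        then consider v' where "v' \<in> V" "e = {inn v', out v'}"
          | u where "2 * N \<le> u" "e = {par u, u}"
          | v' w' where "(v', w') \<in> A" "e = {out v', inn w'}"
          by (auto simp: tree_def base_def)
        then show "e \<in> (\<lambda>u. {c, u}) ` ?X"
        proof cases
          case (1 v')
          then show ?thesis using e \<open>c = inn v\<close> \<open>v \<in> V\<close> by auto
        next
          case (2 u)
          then show ?thesis using e hung[of u] hung_edge[of u] \<open>c = inn v\<close> \<open>v \<in> V\<close> src by auto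
        next
          case 3
          then have "w' \<in> V" "w' \<noteq> src" using AV src' by auto
          then have "w' = v" using 3 e 1 by auto
          then show ?thesis using 3 \<open>w' \<noteq> src\<close> 1 by (auto simp: insert_commute)
        qed
      qed
      then have "vdegree (tree A) c \<le> card ?X"
        by (rule bound) (use fin fin_image[OF AV'] in auto)
      also have "\<dots> \<le> card (leaves c) + card {out v}
          + card (if v = src then {core_end} else out ` (A\<inverse> `` {v}))"
        by (rule card_Un3_le)
      also have "\<dots> \<le> (k - 2) + 1 + 1"
        using card_image_le[OF fin_image[OF AV'], of out v]
          card_single_valued_Image_le[OF sv(2), of v]
        by (simp add: card_leaves)
      finally show ?thesis using k by simp
    qed
  qed
qed

text \<open>The nodes with reachable entrance form a set that no arc enters or leaves, hence all of
  \<open>V\<close>. The other vertices follow by induction, since parents have smaller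
  numbers.\<close>

lemma graph_connected_tree:
  assumes A: "ham_arcs V src A"
  shows "graph_connected n (tree A)"
proof -
  define R where "R = (\<lambda>a b. {a, b} \<in> tree A)"
  have sym: "R a b \<Longrightarrow> R b a" for a b by (simp add: R_def insert_commute)
  have node: "R (inn v) (out v)" if "v \<in> V" for v
    using that by (auto simp: R_def tree_def base_def)
  have arc: "R (out v) (inn w)" if "(v, w) \<in> A" for v w
    using that by (auto simp: R_def tree_def)
  have hung: "R (par u) u" if "2 * N \<le> u" "u < n" for u
    using that by (auto simp: R_def tree_def base_def)
  have AV: "A \<subseteq> V \<times> V" using A by (simp add: ham_arcs_def)
  define S where "S = {v. R\<^sup>*\<^sup>* (inn src) (inn v)}"
  have closed: "v \<in> S \<longleftrightarrow> w \<in> S" if "(v, w) \<in> A" for v w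
  proof -
    have "v \<in> V" using that AV by auto
    then have "R\<^sup>*\<^sup>* (inn v) (inn w)" "R\<^sup>*\<^sup>* (inn w) (inn v)"
      using node arc[OF that] sym by (meson r_into_rtranclp rtranclp.rtrancl_into_rtrancl)+
    then show ?thesis unfolding S_def by (auto intro: rtranclp_trans)
  qed
  have "src \<in> S" by (simp add: S_def)
  with A closed have VS: "V \<subseteq> S" unfolding ham_arcs_def by blast
  have "v < n \<longrightarrow> R\<^sup>*\<^sup>* (inn src) v" for v
  proof (induction v rule: less_induct)
    case (less v)
    show ?case
    proof
      assume v: "v < n"
      show "R\<^sup>*\<^sup>* (inn src) v"
      proof (cases "v < 2 * N")
        case True
        then show ?thesis
          by (cases rule: core_cases)
            (use VS node in \<open>auto simp: S_def intro: rtranclp.rtrancl_into_rtrancl\<close>)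
      next
        case False
        then show ?thesis using less[of "par v"] par_less[of v] hung[of v] v
          by (auto intro: rtranclp.rtrancl_into_rtrancl)
      qed
    qed
  qed
  then show ?thesis unfolding R_def by (intro graph_connectedI) blast
qed

text \<open>There are at most n - N base edges and N - 1 arc edges, together fewer than n.\<close>

lemma dc_tree_tree:
  assumes A: "ham_arcs V src A"
  shows "dc_tree n k (tree A)"
proof -
  have AV: "A \<subseteq> V \<times> V" and "card A + 1 = N" using A by (simp_all add: ham_arcs_def card_V)
  moreover have "N \<le> n" using core_bound core_end_le by simp
  ultimately have "card (tree A) < n" using card_tree_le[OF AV] by simp
  then show ?thesis
    unfolding dc_tree_def
    using vdegree_tree_le[OF A] spanning_treeI[OF tree_subset[OF AV] graph_connected_tree[OF A]]
    by blast
qed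

text \<open>Contracts each node with everything hanging from it, so that paths in the tree become
  walks along arcs, in either direction.\<close>

definition node_of :: "nat \<Rightarrow> 'v" where
  "node_of u = (if u < core_end then inv_into V enc (u mod (2 * N) div 2) else src)"

lemma node_of_core: "v \<in> V \<Longrightarrow> node_of (inn v) = v" "v \<in> V \<Longrightarrow> node_of (out v) = v"
proof -
  have "inv_into V enc (enc v) = v" if "v \<in> V"
    using enc that by (rule bij_betw_inv_into_left)
  then show "v \<in> V \<Longrightarrow> node_of (inn v) = v" "v \<in> V \<Longrightarrow> node_of (out v) = v"
    using core_less[of v] core_bound by (auto simp: node_of_def inn_def out_def)
qed

lemma node_of_par: "2 * N \<le> u \<Longrightarrow> node_of (par u) = node_of u"
proof -
  assume u: "2 * N \<le> u"
  have "u mod (2 * N) < core_end"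
    using core_bound N_pos by (meson mod_less_divisor mult_pos_pos order.strict_trans2 zero_less_numeral)
  then show ?thesis
    using u node_of_core(1)[OF src]
    by (auto simp: par_def node_of_def[of u]) (auto simp: node_of_def)
qed

text \<open>\<open>T\<close> contains the common base of both trees, so it is determined by its arc
  edges. The degree bound makes these arcs injective in both directions, counting edges gives their
  number, and contraction by \<open>node_of\<close> transfers connectedness.\<close>

lemma dc_tree_between:
  assumes A1: "ham_arcs V src A1" and A2: "ham_arcs V src A2"
    and T: "dc_tree n k T" "tree A1 \<inter> tree A2 \<subseteq> T" "T \<subseteq> tree A1 \<union> tree A2"
  obtains A where "ham_arcs V src A" "A1 \<inter> A2 \<subseteq> A" "A \<subseteq> A1 \<union> A2" "T = tree A"
proof -
  define A where "A = {(v, w) \<in> A1 \<union> A2. {out v, inn w} \<in> T}"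
  have AV: "A \<subseteq> V \<times> V" and irrefl: "\<And>v w. (v, w) \<in> A \<Longrightarrow> v \<noteq> w \<and> w \<noteq> src"
    using A1 A2 by (auto simp: A_def ham_arcs_def)
  have sub: "A1 \<inter> A2 \<subseteq> A" "A \<subseteq> A1 \<union> A2"
    using T(2) by (auto simp: A_def tree_def)
  have base: "base \<subseteq> T" using T(2) by (auto simp: tree_def)
  have TA: "T = tree A"
    using base T(3) by (auto simp: A_def tree_def)
  have deg: "vdegree T v \<le> k" if "v < n" for v using T(1) that by (simp add: dc_tree_def)
  have con: "graph_connected n T" using T(1) by (simp add: dc_tree_def spanning_tree_def)
  have fin: "finite T" using TA finite_tree[OF AV] by simp
  have nodeT: "{inn v, out v} \<in> T" if "v \<in> V" for v using base that by (auto simp: base_def)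
  have arcT: "{out v, inn w} \<in> T" if "(v, w) \<in> A" for v w using that by (auto simp: A_def)
  have sv: "w = w'" if "(v, w) \<in> A" "(v, w') \<in> A" for v w w'
  proof (rule ccontr)
    assume "w \<noteq> w'"
    have V: "v \<in> V" "w \<in> V" "w' \<in> V" using that AV by auto
    \<comment> \<open>With two outgoing arcs, the exit of \<open>v\<close> would have three
      neighbours in the core.\<close>
    have "card {inn v, inn w, inn w'} \<le> 2"
      by (rule card_core_neighbours_le[OF deg base fin, of "out v"])
        (use V nodeT arcT that core_less in \<open>auto simp: insert_commute\<close>)
    with V \<open>w \<noteq> w'\<close> irrefl[OF that(1)] irrefl[OF that(2)] show False by (auto simp: card_insert_if)
  qed
  have sv': "v = v'" if "(v, w) \<in> A" "(v', w) \<in> A" for v v' w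
  proof (rule ccontr)
    assume "v \<noteq> v'"
    have V: "w \<in> V" "v \<in> V" "v' \<in> V" using that AV by auto
    have "card {out w, out v, out v'} \<le> 2"
      by (rule card_core_neighbours_le[OF deg base fin, of "inn w"])
        (use V nodeT arcT that core_less in \<open>auto simp: insert_commute\<close>)
    with V \<open>v \<noteq> v'\<close> irrefl[OF that(1)] irrefl[OF that(2)] show False by (auto simp: card_insert_if)
  qed
  have "card A + 1 = card V"
  proof -
    have "n \<le> card T + 1" using con fin by (rule graph_connected_card_ge)
    then have "N \<le> card A + 1" using card_tree_le[OF AV] TA core_bound core_end_le N_pos by simp
    \<comment> \<open>Every node is entered at most once, and \<open>src\<close> never.\<close>
    moreover have "card A \<le> card (V - {src})"
    proof (rule card_inj_on_le)
      show "inj_on snd A"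
      proof (rule inj_onI)
        fix p p' assume "p \<in> A" "p' \<in> A" "snd p = snd p'"
        then show "p = p'" using sv'[of "fst p" "snd p" "fst p'"] by (cases p; cases p') simp
      qed
      show "snd ` A \<subseteq> V - {src}"
      proof
        fix w assume "w \<in> snd ` A"
        then obtain v where "(v, w) \<in> A" by auto
        then show "w \<in> V - {src}" using AV irrefl[of v w] by auto
      qed
    qed (simp add: finite_V)
    ultimately show ?thesis using src finite_V card_V N_pos by simp
  qed
  moreover have "V \<subseteq> S" if S: "src \<in> S" "\<forall>(v, w)\<in>A. v \<in> S \<longleftrightarrow> w \<in> S" for S
  proof
    fix v assume v: "v \<in> V"
    have step: "node_of a \<in> S \<longleftrightarrow> node_of b \<in> S" if "{a, b} \<in> T" for a b
    proof -
      from that TA consider v where "v \<in> V" "{a, b} = {inn v, out v}"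
        | u where "2 * N \<le> u" "{a, b} = {par u, u}"
        | v w where "(v, w) \<in> A" "{a, b} = {out v, inn w}"
        by (auto simp: tree_def base_def)
      then show ?thesis
      proof cases
        case 1
        then show ?thesis by (auto simp: doubleton_eq_iff node_of_core)
      next
        case 2
        then show ?thesis by (auto simp: doubleton_eq_iff node_of_par)
      next
        case 3
        then have "v \<in> V" "w \<in> V" "v \<in> S \<longleftrightarrow> w \<in> S" using AV S(2) by auto
        then show ?thesis using 3 by (auto simp: doubleton_eq_iff node_of_core)
      qed
    qed
    have "(\<lambda>a b. {a, b} \<in> T)\<^sup>*\<^sup>* (inn src) (inn v)"
      using con core_less(1)[OF src] core_less(1)[OF v] core_bound core_end_le
      by (simp add: graph_connected_def)
    then have "node_of (inn v) \<in> S"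
      by (induction rule: rtranclp_induct) (use S(1) src node_of_core step in auto)
    then show "v \<in> S" using v node_of_core by simp
  qed
  moreover have "single_valued A" "single_valued (A\<inverse>)"
    using sv sv' by (simp_all add: single_valued_def)
  moreover have "\<forall>(v, w)\<in>A. v \<noteq> w \<and> w \<noteq> src" using irrefl by auto
  ultimately have "ham_arcs V src A"
    unfolding ham_arcs_def using AV by (intro conjI allI impI) simp_all
  with sub TA that show thesis by blast
qed

end

lemma card_le_clique_number_of_ham_arcs:
  fixes idx :: "nat set \<Rightarrow> 'd::finite" and V :: "'v set"
  assumes bij: "bij_betw idx (Kn_edges n) UNIV"
    and "finite V" "src \<in> V" "2 \<le> k" "2 * card V * (k - 1) \<le> n"
    and ham: "\<And>A. A \<in> \<A> \<Longrightarrow> ham_arcs V src A"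
    and between: "\<And>A1 A2 A. A1 \<in> \<A> \<Longrightarrow> A2 \<in> \<A> \<Longrightarrow> ham_arcs V src A \<Longrightarrow>
      A1 \<inter> A2 \<subseteq> A \<Longrightarrow> A \<subseteq> A1 \<union> A2 \<Longrightarrow> A = A1 \<or> A = A2"
  shows "card \<A> \<le> skel_clique_number (DCMST n k idx)"
proof -
  obtain enc where "bij_betw enc V {..<card V}"
    using ex_bij_betw_finite_nat[OF \<open>finite V\<close>] by (auto simp: atLeast0LessThan)
  then interpret node_embedding n k "card V" V enc src
    using assms by unfold_locales auto
  have "card (tree ` \<A>) \<le> skel_clique_number (DCMST n k idx)"
  proof (rule card_le_skel_clique_numberI[OF bij])
    fix T1 T2 T
    assume T: "T1 \<in> tree ` \<A>" "T2 \<in> tree ` \<A>" "dc_tree n k T" "T1 \<inter> T2 \<subseteq> T" "T \<subseteq> T1 \<union> T2"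
    from T(1,2) obtain A1 A2 where A: "A1 \<in> \<A>" "A2 \<in> \<A>" "T1 = tree A1" "T2 = tree A2" by blast
    obtain A where "ham_arcs V src A" "A1 \<inter> A2 \<subseteq> A" "A \<subseteq> A1 \<union> A2" "T = tree A"
      by (rule dc_tree_between[OF ham ham, of A1 A2 T]) (use A T in auto)
    with A show "T = T1 \<or> T = T2" using between[of A1 A2 A] by blast
  qed (use dc_tree_tree ham in auto)
  moreover have "inj_on tree \<A>"
    by (rule inj_onI) (rule tree_inject[OF ham ham])
  ultimately show ?thesis by (simp add: card_image)
qed

section \<open>Paths with coupled crossing exchanges\<close>

text \<open>
  The basic path runs through the segments 0, ..., 6B. Gap h lies between the segments h and h + 1, and
  block b consists of the gaps 6b, ..., 6b + 5. The gaps g and g + 3 with g mod 6 < 3 form a chord;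
  toggling it exchanges the targets of the two gaps. The three chords of a block cross pairwise, so the
  block is still traversed by a single path iff an even number of them is toggled.

  A variable u toggles the chords \<open>G u t\<close> for \<open>t < q u\<close> simultaneously. To enforce simultaneity, the node
  \<open>Item u t\<close> sits in chord t when u is on and in chord t + 1 when u is off.
\<close>

datatype 'u node = Seg nat | Item 'u nat

definition first_gap :: "nat \<Rightarrow> nat" where "first_gap h = (if h mod 6 < 3 then h else h - 3)"
definition partner :: "nat \<Rightarrow> nat" where "partner h = (if h mod 6 < 3 then h + 3 else h - 3)"

lemma seg_cases:
  obtains b j :: nat where "h = 6 * b + j" "j = 0 \<or> j = 1 \<or> j = 2 \<or> j = 3 \<or> j = 4 \<or> j = 5"
proof
  show "h = 6 * (h div 6) + h mod 6" by simp
  have "h mod 6 < 6" by simp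
  then show "h mod 6 = 0 \<or> h mod 6 = 1 \<or> h mod 6 = 2 \<or> h mod 6 = 3 \<or> h mod 6 = 4 \<or> h mod 6 = 5"
    by linarith
qed

lemma Suc_6_mult_simps [simp]:
  "Suc (6 * b) div 6 = b" "Suc (Suc (6 * b)) div 6 = b" "Suc (Suc (6 * b)) mod 6 = 2"
  by presburger+

lemma add_3_mod_6: "g mod 6 < 3 \<Longrightarrow> \<not> (g + 3) mod 6 < (3 :: nat)"
  by presburger

lemma partner_simps [simp]:
  "first_gap (partner h) = first_gap h" "partner (partner h) = h" "partner h div 6 = h div 6"
  "first_gap h mod 6 < 3"
proof -
  obtain b j where "h = 6 * b + j" "j = 0 \<or> j = 1 \<or> j = 2 \<or> j = 3 \<or> j = 4 \<or> j = 5"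
    by (rule seg_cases)
  then consider "h = 6 * b" | "h = 6 * b + 1" | "h = 6 * b + 2" | "h = 6 * b + 3" | "h = 6 * b + 4"
    | "h = 6 * b + 5"
    by auto
  then have "first_gap (partner h) = first_gap h \<and> partner (partner h) = h \<and> partner h div 6 = h div 6
      \<and> first_gap h mod 6 < 3"
    by cases (simp_all add: first_gap_def partner_def)
  then show "first_gap (partner h) = first_gap h" "partner (partner h) = h"
    "partner h div 6 = h div 6" "first_gap h mod 6 < 3" by auto
qed

lemma less_6_mult_iff: "h < 6 * b \<longleftrightarrow> h div 6 < (b :: nat)"
  by (simp add: div_less_iff_less_mult mult.commute)

lemma partner_less_iff [simp]: "partner h < 6 * b \<longleftrightarrow> h < 6 * b"
  by (simp only: less_6_mult_iff partner_simps)

text \<open>A chord is named by its lower gap. Since \<open>var\<close> and \<open>pos\<close>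
  invert \<open>G\<close>, each chord belongs to exactly one variable and has one position in the
  list of that variable.\<close>

locale chain_system =
  fixes B :: nat and U :: "'u set" and q :: "'u \<Rightarrow> nat" and G :: "'u \<Rightarrow> nat \<Rightarrow> nat"
    and var :: "nat \<Rightarrow> 'u" and pos :: "nat \<Rightarrow> nat"
  assumes finite_U: "finite U"
    and chord: "\<And>g. g < 6 * B \<Longrightarrow> g mod 6 < 3 \<Longrightarrow>
      var g \<in> U \<and> pos g < q (var g) \<and> G (var g) (pos g) = g"
    and G: "\<And>u t. u \<in> U \<Longrightarrow> t < q u \<Longrightarrow>
      G u t < 6 * B \<and> G u t mod 6 < 3 \<and> var (G u t) = u \<and> pos (G u t) = t"
begin

section \<open>Successors on the modified path\<close>

definition V :: "'u node set" where
  "V = Seg ` {..6 * B} \<union> {Item u t | u t. u \<in> U \<and> t + 1 < q u}"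

text \<open>An item is always entered from the lower segment of a chord; upper segments lead
  directly to segments. Thus \<open>Item u t\<close> is the on-target of \<open>G u t\<close> and
  the off-target of \<open>G u (t + 1)\<close>, which couples consecutive chords.\<close>

fun nxt :: "bool \<Rightarrow> 'u node \<Rightarrow> 'u node" where
  "nxt s (Seg h) =
     (if h mod 6 < 3
      then if s then if pos h + 1 < q (var h) then Item (var h) (pos h) else Seg (h + 4)
           else if pos h = 0 then Seg (h + 1) else Item (var h) (pos h - 1)
      else if s then Seg (h - 2) else Seg (h + 1))"
| "nxt s (Item u t) = Seg (if s then G u t + 4 else G u (t + 1) + 1)"

fun own :: "'u node \<Rightarrow> 'u" where
  "own (Seg h) = var (first_gap h)"
| "own (Item u t) = u"

abbreviation succ :: "('u \<Rightarrow> bool) \<Rightarrow> 'u node \<Rightarrow> 'u node" where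
  "succ z v \<equiv> nxt (z (own v)) v"

definition arcs :: "('u \<Rightarrow> bool) \<Rightarrow> 'u node rel" where
  "arcs z = (\<lambda>v. (v, succ z v)) ` (V - {Seg (6 * B)})"

text \<open>The next segment on the path after segment h, ignoring the item that may lie in between.\<close>

definition skip :: "('u \<Rightarrow> bool) \<Rightarrow> nat \<Rightarrow> nat" where
  "skip z h = Suc (if z (var (first_gap h)) then partner h else h)"

text \<open>Equivalently, each block has an even number of toggled chords.\<close>

definition feasible :: "('u \<Rightarrow> bool) \<Rightarrow> bool" where
  "feasible z \<longleftrightarrow> (\<forall>b<B. z (var (6 * b + 2)) \<longleftrightarrow> z (var (6 * b)) \<noteq> z (var (6 * b + 1)))"

lemma finite_V: "finite V"
proof -
  have "V \<subseteq> Seg ` {..6 * B} \<union> (\<lambda>(u, t). Item u t) ` (SIGMA u:U. {..<q u})"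
    by (force simp: V_def)
  then show ?thesis by (rule finite_subset) (use finite_U in auto)
qed

lemma Seg_in_V [simp]: "Seg h \<in> V \<longleftrightarrow> h \<le> 6 * B"
  and Item_in_V [simp]: "Item u t \<in> V \<longleftrightarrow> u \<in> U \<and> t + 1 < q u"
  by (auto simp: V_def)

lemma chord_first_gap:
  assumes "h < 6 * B"
  shows "var (first_gap h) \<in> U" "pos (first_gap h) < q (var (first_gap h))"
    "G (var (first_gap h)) (pos (first_gap h)) = first_gap h"
proof -
  have "first_gap h \<le> h" by (simp add: first_gap_def)
  with assms have "first_gap h < 6 * B" "first_gap h mod 6 < 3" by simp_all
  then show "var (first_gap h) \<in> U" "pos (first_gap h) < q (var (first_gap h))"
    "G (var (first_gap h)) (pos (first_gap h)) = first_gap h"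
    using chord by blast+
qed

lemma chord_end_le: "g < 6 * B \<Longrightarrow> g mod 6 < 3 \<Longrightarrow> g + 4 \<le> 6 * B"
  by presburger

text \<open>At most one item lies between consecutive segments, so suppressing the items reduces the
  path to the map \<open>skip\<close>.\<close>

lemma succ_Seg_cases:
  assumes "h < 6 * B"
  obtains "succ z (Seg h) = Seg (skip z h)"
  | u t where "Item u t \<in> V" "succ z (Seg h) = Item u t" "succ z (Item u t) = Seg (skip z h)"
proof (cases "h mod 6 < 3")
  case True
  then have fg: "first_gap h = h" by (simp add: first_gap_def)
  note c = chord_first_gap[OF assms, unfolded fg]
  show thesis
  proof (cases "z (var h)")
    case z: True
    show thesis
    proof (cases "pos h + 1 < q (var h)")
      case lt: True
      show thesis
        by (rule that(2)[of "var h" "pos h"]) (use True c fg z lt in \<open>auto simp: skip_def partner_def\<close>)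
    next
      case False
      show thesis by (rule that(1)) (use True fg z False in \<open>auto simp: skip_def partner_def\<close>)
    qed
  next
    case z: False
    show thesis
    proof (cases "pos h = 0")
      case True
      then show thesis using \<open>h mod 6 < 3\<close> fg z by (intro that(1)) (auto simp: skip_def)
    next
      case False
      show thesis
        by (rule that(2)[of "var h" "pos h - 1"]) (use True c fg z False in \<open>auto simp: skip_def\<close>)
    qed
  qed
next
  case False
  moreover have "Suc (h - 3) = h - 2" using False by (cases "h < 3") auto
  ultimately show thesis by (intro that(1)) (auto simp: skip_def partner_def)
qed

lemma skip_le: "h < 6 * B \<Longrightarrow> skip z h \<le> 6 * B"
  by (auto simp: skip_def Suc_le_eq)

text \<open>Up to the shift by one, \<open>skip z\<close> swaps the two gaps of each toggled chord,
  which is an involution because both gaps share their variable.\<close>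

lemma skip_inject: "skip z h = skip z h' \<Longrightarrow> h = h'"
  unfolding skip_def by (auto split: if_splits) (metis partner_simps)+

lemma succ_in_V:
  assumes "v \<in> V" "v \<noteq> Seg (6 * B)"
  shows "succ z v \<in> V" "succ z v \<noteq> Seg 0" "succ z v \<noteq> v"
proof -
  have "succ z v \<in> V \<and> succ z v \<noteq> Seg 0 \<and> succ z v \<noteq> v"
  proof (cases v)
    case (Seg h)
    with assms have h: "h < 6 * B" by simp
    have "skip z h \<noteq> h" unfolding skip_def partner_def by auto
    then show ?thesis unfolding Seg
      by (rule_tac succ_Seg_cases[OF h, of z])
        (use skip_le[OF h] in \<open>auto simp: skip_def simp del: nxt.simps own.simps\<close>)
  next
    case (Item u t)
    with assms have "u \<in> U" "t < q u" "t + 1 < q u" by auto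
    then show ?thesis
      using Item G[of u t] G[of u "t + 1"] chord_end_le[of "G u t"] chord_end_le[of "G u (t + 1)"]
      by auto
  qed
  then show "succ z v \<in> V" "succ z v \<noteq> Seg 0" "succ z v \<noteq> v" by auto
qed

lemma succ_eq_Item:
  assumes "v \<in> V" "v \<noteq> Seg (6 * B)" "succ z v = Item u t"
  shows "v = Seg (G u (if z u then t else t + 1))"
proof (cases v)
  case (Seg h)
  then have h: "h < 6 * B" using assms by simp
  have "h mod 6 < 3" using assms Seg by (auto split: if_splits)
  then have fg: "first_gap h = h" by (simp add: first_gap_def)
  show ?thesis using assms(3) chord_first_gap[OF h] fg Seg by (auto split: if_splits)
qed (use assms in auto)

lemma succ_eq_Seg:
  assumes "v \<in> V" "v \<noteq> Seg (6 * B)" "succ z v = Seg l"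
  obtains h where "h < 6 * B" "l = skip z h" "v = Seg h \<or> succ z (Seg h) = v"
proof (cases v)
  case (Seg h)
  then have h: "h < 6 * B" using assms by simp
  from h show thesis
    by (rule succ_Seg_cases[of _ z]) (use assms(3) Seg h that in auto)
next
  case (Item u t)
  then have ut: "u \<in> U" "t + 1 < q u" using assms by auto
  define h where "h = G u (if z u then t else t + 1)"
  have h: "h < 6 * B" "h mod 6 < 3" "var h = u" "pos h = (if z u then t else t + 1)"
    using G[of u "if z u then t else t + 1"] ut by (auto simp: h_def)
  then have "first_gap h = h" by (simp add: first_gap_def)
  then have s: "succ z (Seg h) = v" using h ut Item by simp
  from h(1) show thesis
    by (rule succ_Seg_cases[of _ z]) (use s assms(3) Item h(1) that in \<open>auto simp del: nxt.simps own.simps\<close>)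
qed

text \<open>An item determines its predecessor explicitly. Two predecessors of a segment lie on the
  same link of \<open>skip\<close>; if distinct, one would precede the other and would force a node
  to be its own successor.\<close>

lemma inj_on_succ: "inj_on (succ z) (V - {Seg (6 * B)})"
proof (rule inj_onI)
  fix v w assume v: "v \<in> V - {Seg (6 * B)}" and w: "w \<in> V - {Seg (6 * B)}"
    and eq: "succ z v = succ z w"
  show "v = w"
  proof (cases "succ z v")
    case (Item u t)
    then show ?thesis using succ_eq_Item[of v z u t] succ_eq_Item[of w z u t] v w eq by simp
  next
    case (Seg l)
    obtain h where h: "l = skip z h" "v = Seg h \<or> succ z (Seg h) = v"
      using succ_eq_Seg[of v z l] v Seg by blast
    obtain h' where h': "l = skip z h'" "w = Seg h' \<or> succ z (Seg h') = w"
      using succ_eq_Seg[of w z l] w Seg[unfolded eq] by blast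
    have "h' = h" using h h' skip_inject by metis
    then consider "v = w" | "v = Seg h" "succ z v = w" | "w = Seg h" "succ z w = v"
      using h h' by metis
    then show ?thesis
    proof cases
      case 2
      with eq succ_in_V[of w z] w show ?thesis by simp
    next
      case 3
      with eq succ_in_V[of v z] v show ?thesis by simp
    qed
  qed
qed

lemma card_arcs: "card (arcs z) + 1 = card V"
proof -
  have "inj_on (\<lambda>v. (v, succ z v)) (V - {Seg (6 * B)})" by (simp add: inj_on_def)
  then have "card (arcs z) = card (V - {Seg (6 * B)})" unfolding arcs_def by (rule card_image)
  moreover have "Seg (6 * B) \<in> V" by simp
  ultimately show ?thesis using card_Suc_Diff1[OF finite_V, of "Seg (6 * B)"] by simp
qed

section \<open>Feasibility and connectedness\<close>

lemma skip_block:
  "skip z (6 * b) = (if z (var (6 * b)) then 6 * b + 4 else 6 * b + 1)"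
  "skip z (6 * b + 1) = (if z (var (6 * b + 1)) then 6 * b + 5 else 6 * b + 2)"
  "skip z (6 * b + 2) = (if z (var (6 * b + 2)) then 6 * b + 6 else 6 * b + 3)"
  "skip z (6 * b + 3) = (if z (var (6 * b)) then 6 * b + 1 else 6 * b + 4)"
  "skip z (6 * b + 4) = (if z (var (6 * b + 1)) then 6 * b + 2 else 6 * b + 5)"
  "skip z (6 * b + 5) = (if z (var (6 * b + 2)) then 6 * b + 3 else 6 * b + 6)"
  by (auto simp: skip_def first_gap_def partner_def)

text \<open>In each of the four feasible states of a block, the links join all seven segments from
  \<open>6 * b\<close> to \<open>6 * b + 6\<close>. Consecutive blocks share a segment, and each
  item leads to a segment.\<close>

lemma arcs_connected:
  assumes "feasible z" "Seg 0 \<in> S" and closed: "\<forall>(v, w)\<in>arcs z. v \<in> S \<longleftrightarrow> w \<in> S"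
  shows "V \<subseteq> S"
proof
  have step: "v \<in> S \<longleftrightarrow> succ z v \<in> S" if "v \<in> V" "v \<noteq> Seg (6 * B)" for v
    using closed that by (auto simp: arcs_def)
  have link: "Seg h \<in> S \<longleftrightarrow> Seg (skip z h) \<in> S" if h: "h < 6 * B" for h
    by (rule succ_Seg_cases[OF h, of z])
      (use step[of "Seg h"] step[of "Item _ _"] h in \<open>auto simp del: nxt.simps own.simps\<close>)
  have block: "\<forall>j\<le>6. Seg (6 * b + j) \<in> S" if "b < B" "Seg (6 * b) \<in> S" for b
  proof -
    have "Seg (6 * b + j) \<in> S \<longleftrightarrow> Seg (skip z (6 * b + j)) \<in> S" if "j < 6" for j
      using link[of "6 * b + j"] \<open>b < B\<close> that by simp
    from this[of 0] this[of 1] this[of 2] this[of 3] this[of 4] this[of 5]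
    have "\<forall>j\<in>{0, 1, 2, 3, 4, 5, 6}. Seg (6 * b + j) \<in> S"
      using that assms(1) unfolding feasible_def
      by (cases "z (var (6 * b))"; cases "z (var (6 * b + 1))") (simp_all add: skip_block[simplified])
    moreover have "j \<in> {0, 1, 2, 3, 4, 5, 6}" if "j \<le> 6" for j :: nat
      using that by auto
    ultimately show ?thesis by blast
  qed
  have start: "b \<le> B \<longrightarrow> Seg (6 * b) \<in> S" for b
  proof (induction b)
    case (Suc b)
    then show ?case using block[of b] by (auto simp: add.commute)
  qed (use assms in simp)
  have segs: "Seg h \<in> S" if "h \<le> 6 * B" for h
  proof (cases "h = 6 * B")
    case False
    then have b: "h div 6 < B" using that by (simp add: div_less_iff_less_mult)
    moreover have "h mod 6 \<le> 6" by (simp add: less_imp_le)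
    ultimately have "Seg (6 * (h div 6) + h mod 6) \<in> S"
      using block start by (meson less_imp_le)
    then show ?thesis by simp
  qed (use start in simp)
  fix v assume v: "v \<in> V"
  show "v \<in> S"
  proof (cases v)
    case (Item u t)
    have "succ z v \<in> V" using succ_in_V[of v z] v Item by simp
    then have "succ z v \<in> S" using segs Item by auto
    then show ?thesis using step[of v] v Item by simp
  qed (use segs v in simp)
qed

lemma ham_arcs_arcs:
  assumes "feasible z"
  shows "ham_arcs V (Seg 0) (arcs z)"
  unfolding ham_arcs_def
proof (intro conjI)
  show "single_valued ((arcs z)\<inverse>)"
    using inj_on_succ[of z] by (auto simp: arcs_def single_valued_def inj_on_def)
  show "arcs z \<subseteq> V \<times> V" "\<forall>(v, w)\<in>arcs z. v \<noteq> w \<and> w \<noteq> Seg 0"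
    using succ_in_V(1,2)[where z = z] succ_in_V(3)[where z = z, THEN not_sym]
    unfolding arcs_def by (auto simp del: nxt.simps own.simps)
qed (use arcs_connected[OF assms] card_arcs in \<open>auto simp: arcs_def single_valued_def\<close>)

text \<open>An odd number of toggled chords closes three segments of the block into a cycle that
  always contains \<open>6 * b + 3\<close>. The complement of this cycle, with each item on the side
  of its successor, violates connectedness.\<close>

lemma feasible_if_ham_arcs:
  assumes "ham_arcs V (Seg 0) (arcs z)"
  shows "feasible z"
proof (rule ccontr)
  assume "\<not> feasible z"
  then obtain b where b: "b < B"
    and odd: "\<not> (z (var (6 * b + 2)) \<longleftrightarrow> z (var (6 * b)) \<noteq> z (var (6 * b + 1)))"
    by (auto simp: feasible_def)
  \<comment> \<open>The segments of block b that are cut off into a cycle.\<close>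
  define J :: "nat set" where
    "J = (if z (var (6 * b)) then if z (var (6 * b + 1)) then {1, 3, 5} else {1, 2, 3}
          else if z (var (6 * b + 1)) then {2, 3, 4} else {3, 4, 5})"
  define C where "C = (\<lambda>j. 6 * b + j) ` J"
  have J: "J \<subseteq> {1..5}" "3 \<in> J" by (auto simp: J_def)
  have C_iff: "6 * b + j \<in> C \<longleftrightarrow> j \<in> J" for j by (auto simp: C_def)
  have C_block: "h div 6 = b" "(h - 1) div 6 = b" if h: "h \<in> C" for h
  proof -
    obtain j where "h = 6 * b + j" "j \<in> J" using h by (auto simp: C_def)
    moreover from this J(1) have "1 \<le> j" "j \<le> 5" by auto
    ultimately show "h div 6 = b" "(h - 1) div 6 = b" by simp_all
  qed
  have closed: "h \<in> C \<longleftrightarrow> skip z h \<in> C" if "h < 6 * B" for h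
  proof (cases "h div 6 = b")
    case True
    obtain j where h: "h = 6 * b + j"
      and "j = 0 \<or> j = 1 \<or> j = 2 \<or> j = 3 \<or> j = 4 \<or> j = 5"
      by (rule seg_cases[of h]) (use True in auto)
    then consider "j = 0" | "j = 1" | "j = 2" | "j = 3" | "j = 4" | "j = 5" by blast
    then have "j \<in> J \<longleftrightarrow> skip z (6 * b + j) \<in> C"
      by cases (use odd C_iff[of 1] C_iff[of 2] C_iff[of 3] C_iff[of 4] C_iff[of 5] C_iff[of 6]
        in \<open>simp_all add: skip_block[simplified] J_def split: if_splits\<close>)
    then show ?thesis using h C_iff by simp
  next
    case False
    \<comment> \<open>Subtracting one accounts for a block ending at the first segment of the next
      block.\<close>
    have "(skip z h - 1) div 6 = h div 6" by (simp add: skip_def)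
    then show ?thesis using False C_block by metis
  qed
  define S where "S = {v. case v of Seg h \<Rightarrow> h \<notin> C | Item u t \<Rightarrow> succ z v \<notin> Seg ` C}"
  have "v \<in> S \<longleftrightarrow> w \<in> S" if "(v, w) \<in> arcs z" for v w
  proof -
    have v: "v \<in> V" "v \<noteq> Seg (6 * B)" and w: "w = succ z v" using that by (auto simp: arcs_def)
    show ?thesis
    proof (cases v)
      case (Seg h)
      then have h: "h < 6 * B" using v by simp
      from h show ?thesis
        by (rule succ_Seg_cases[of _ z])
          (use Seg w closed[OF h] in \<open>auto simp: S_def image_iff simp del: nxt.simps own.simps\<close>)
    next
      case (Item u t)
      then show ?thesis using w by (auto simp: S_def)
    qed
  qed
  moreover have "Seg 0 \<in> S" using J by (auto simp: S_def C_def)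
  ultimately have "V \<subseteq> S" using assms unfolding ham_arcs_def by blast
  moreover have "Seg (6 * b + 3) \<in> V" using b by simp
  moreover have "Seg (6 * b + 3) \<notin> S" using C_iff J by (simp add: S_def)
  ultimately show False by blast
qed

text \<open>The arc out of the upper segment of the first chord reveals the value of
  \<open>u\<close>, since its on-target and off-target are different segments.\<close>

lemma arcs_subset_Un_imp:
  assumes "arcs w \<subseteq> arcs x \<union> arcs y" "u \<in> U" "0 < q u"
  shows "w u = x u \<or> w u = y u"
proof -
  let ?h = "G u 0 + 3"
  have g: "G u 0 < 6 * B" "G u 0 mod 6 < 3" "var (G u 0) = u" using G[OF assms(2,3)] by auto
  have m: "\<not> ?h mod 6 < 3" "?h < 6 * B"
    using add_3_mod_6[OF g(2)] chord_end_le[OF g(1,2)] by simp_all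
  have "(Seg ?h, succ w (Seg ?h)) \<in> arcs w"
    unfolding arcs_def using m(2) by (intro image_eqI) auto
  then have "(Seg ?h, succ w (Seg ?h)) \<in> arcs x \<union> arcs y" using assms(1) by blast
  then have "succ w (Seg ?h) = succ x (Seg ?h) \<or> succ w (Seg ?h) = succ y (Seg ?h)"
    by (auto simp: arcs_def simp del: nxt.simps)
  moreover have "own (Seg ?h) = u" using m(1) g(3) by (simp add: first_gap_def)
  ultimately show ?thesis using m(1) by (auto split: if_splits)
qed

lemma arcs_cong:
  assumes "\<And>u. u \<in> U \<Longrightarrow> w u = z u"
  shows "arcs w = arcs z"
  unfolding arcs_def
proof (rule image_cong[OF refl])
  fix v assume "v \<in> V - {Seg (6 * B)}"
  then have "own v \<in> U" using chord_first_gap(1) by (cases v) auto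
  then show "(v, succ w v) = (v, succ z v)" using assms by simp
qed

text \<open>Every node but the last takes its on-arc or its off-arc. Once this choice is shown to be
  constant for each variable, it defines \<open>w\<close>, and \<open>arcs w\<close> exhausts
  \<open>A\<close> by cardinality.\<close>

lemma ham_arcs_between:
  assumes A: "ham_arcs V (Seg 0) A" "A \<subseteq> arcs x \<union> arcs y"
  obtains w where "feasible w" "A = arcs w" "\<forall>u\<in>U. 0 < q u \<longrightarrow> w u = x u \<or> w u = y u"
proof -
  have card_A: "card A + 1 = card V" and sv: "single_valued A" and sv': "single_valued (A\<inverse>)"
    and AV: "A \<subseteq> V \<times> V"
    using A(1) by (auto simp: ham_arcs_def)
  have finA: "finite A" using AV finite_V finite_subset by blast
  \<comment> \<open>There are as many arcs as nodes other than the last segment, sources are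
    distinct, and the last segment is no source.\<close>
  have "fst ` A = V - {Seg (6 * B)}"
  proof (rule card_subset_eq)
    show "fst ` A \<subseteq> V - {Seg (6 * B)}" using A(2) by (auto simp: arcs_def)
    have "inj_on fst A" using sv by (auto simp: inj_on_def single_valued_def)
    then have "card (fst ` A) = card A" by (rule card_image)
    then show "card (fst ` A) = card (V - {Seg (6 * B)})" using card_A finite_V by simp
  qed (use finite_V in simp)
  then have some: "(v, nxt True v) \<in> A \<or> (v, nxt False v) \<in> A"
    if v: "v \<in> V" "v \<noteq> Seg (6 * B)" for v
  proof -
    have "v \<in> fst ` A" using v \<open>fst ` A = _\<close> by simp
    then obtain w where "(v, w) \<in> A" by auto
    moreover from this have "w = succ x v \<or> w = succ y v" using A(2) by (auto simp: arcs_def)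
    ultimately show ?thesis by (metis (full_types))
  qed
  define F where "F v \<longleftrightarrow> (v, nxt True v) \<in> A" for v
  \<comment> \<open>If the off-target of \<open>v'\<close> is already entered from \<open>v\<close>,
    only the on-arc is left for \<open>v'\<close>.\<close>
  have F: "F v'" if "F v" "nxt True v = nxt False v'" "v \<noteq> v'" "v' \<in> V" "v' \<noteq> Seg (6 * B)" for v v'
  proof (rule ccontr)
    assume "\<not> F v'"
    then have "(v', nxt False v') \<in> A" using some[of v'] that by (auto simp: F_def)
    then show False using sv' that unfolding F_def single_valued_def by (metis converse_iff)
  qed
  define w where "w u = F (Seg (G u 0))" for u
  \<comment> \<open>Injectivity propagates \<open>F\<close> around one cycle: up along the segments \<open>G u t\<close>, then down along the
    segments \<open>G u t + 3\<close> and the items, and back to the start.\<close>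
  have uniform: "F (Seg (G u t)) = w u" "F (Seg (G u t + 3)) = w u" "t + 1 < q u \<Longrightarrow> F (Item u t) = w u"
    if u: "u \<in> U" and t: "t < q u" for u t
  proof -
    note Gu = G[OF u]
    have in_V: "Seg (G u t) \<in> V" "Seg (G u t) \<noteq> Seg (6 * B)"
      "Seg (G u t + 3) \<in> V" "Seg (G u t + 3) \<noteq> Seg (6 * B)" if "t < q u" for t
      using Gu[OF that] chord_end_le[of "G u t"] by auto
    have mod3: "\<not> (G u t + 3) mod 6 < 3" if "t < q u" for t
      using Gu[OF that] by (intro add_3_mod_6) simp
    have a: "F (Seg (G u (Suc t)))" if "F (Seg (G u t))" "Suc t < q u" for t
      by (rule F[OF that(1)]) (use Gu[of t] Gu[of "Suc t"] in_V[of "Suc t"] that(2) in auto)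
    have a_up: "F (Seg (G u t'))" if "F (Seg (G u t))" "t \<le> t'" "t' < q u" for t t'
      using that(2,3) by (induction t' rule: dec_induct) (use that(1) a in auto)
    have ac: "F (Seg (G u (q u - 1) + 3))" if "F (Seg (G u (q u - 1)))"
      by (rule F[OF that]) (use Gu[of "q u - 1"] in_V[of "q u - 1"] mod3[of "q u - 1"] t in auto)
    have cp: "F (Item u t)" if "F (Seg (G u (Suc t) + 3))" "Suc t < q u" for t
      by (rule F[OF that(1)]) (use mod3[of "Suc t"] that(2) u in auto)
    have pc: "F (Seg (G u t + 3))" if "F (Item u t)" "Suc t < q u" for t
      by (rule F[OF that(1)]) (use mod3[of t] in_V[of t] that(2) in auto)
    have c_down: "F (Seg (G u t + 3))" if "F (Seg (G u t' + 3))" "t \<le> t'" "t' < q u" for t t'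
      using that(2,1,3) by (induction t' rule: dec_induct) (use cp pc in auto)
    have ca: "F (Seg (G u 0))" if "F (Seg (G u 0 + 3))"
      by (rule F[OF that]) (use Gu[of 0] in_V[of 0] mod3[of 0] t in auto)
    have a_c: "F (Seg (G u t + 3))" if "F (Seg (G u s))" "t < q u" "s < q u" for s t
      using a_up[OF that(1), of "q u - 1"] ac c_down[of "q u - 1" t] that by auto
    have c_w: "w u" if "F (Seg (G u t + 3))" "t < q u" for t
      using c_down[OF that(1), of 0] ca that by (simp add: w_def)
    have w_a: "F (Seg (G u t))" if "w u" "t < q u" for t
      using a_up[of 0 t] that by (simp add: w_def)
    show "F (Seg (G u t)) = w u" using a_c c_w w_a t by blast
    show "F (Seg (G u t + 3)) = w u" using a_c c_w w_a t by blast
    show "F (Item u t) = w u" if "t + 1 < q u"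
      using a_c[of "Suc t" "Suc t"] w_a[of "Suc t"] cp[of t] pc[of t] c_w[of t] that t by auto
  qed
  have F_own: "F v = w (own v)" if v: "v \<in> V" "v \<noteq> Seg (6 * B)" for v
  proof (cases v)
    case (Seg h)
    then have h: "h < 6 * B" using v by simp
    note c = chord_first_gap[OF h]
    have "h = first_gap h \<or> h = first_gap h + 3" by (auto simp: first_gap_def)
    then show ?thesis using uniform(1,2)[OF c(1,2)] c(3) Seg by auto
  next
    case (Item u t)
    then show ?thesis using uniform(3)[of u t] v by simp
  qed
  have sub: "arcs w \<subseteq> A"
  proof
    fix p assume "p \<in> arcs w"
    then obtain v where v: "v \<in> V" "v \<noteq> Seg (6 * B)" "p = (v, succ w v)" by (auto simp: arcs_def)
    then show "p \<in> A" using F_own[of v] some[of v] by (cases "w (own v)") (auto simp: F_def)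
  qed
  then have "A = arcs w"
    using card_subset_eq[OF finA sub] card_A card_arcs[of w] by simp
  moreover have "w u = x u \<or> w u = y u" if "u \<in> U" "0 < q u" for u
    using arcs_subset_Un_imp[OF order_trans[OF sub A(2)] that] .
  moreover have "feasible w" using A(1) feasible_if_ham_arcs \<open>A = arcs w\<close> by simp
  ultimately show thesis using that by blast
qed

end

section \<open>A large clique\<close>

lemma card_less_pairs: "2 * card {(i, j). i < j \<and> j < r} + r = r * (r :: nat)"
proof -
  have "{(i, j). i < j \<and> j < r} = prod.swap ` (SIGMA j:{..<r}. {..<j})" by force
  then have "card {(i, j). i < j \<and> j < r} = card (SIGMA j:{..<r}. {..<j})"
    by (simp add: card_image)
  also have "\<dots> = (\<Sum>j<r. j)" by simp
  finally have "card {(i, j). i < j \<and> j < r} = (\<Sum>j<r. j)" .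
  moreover have "2 * (\<Sum>j<r. j) + r = r * r" by (induction r) auto
  ultimately show ?thesis by simp
qed

lemma ex_ham_arcs_family:
  assumes "2 \<le> r"
  obtains V :: "(nat + nat) node set" and src \<A>
  where "finite V" "src \<in> V" "card V + 5 * r \<le> 4 * (r * r) + 1" "card \<A> = 2 ^ r"
    "\<And>A. A \<in> \<A> \<Longrightarrow> ham_arcs V src A"
    "\<And>A1 A2 A. A1 \<in> \<A> \<Longrightarrow> A2 \<in> \<A> \<Longrightarrow> ham_arcs V src A \<Longrightarrow> A \<subseteq> A1 \<union> A2 \<Longrightarrow>
      A = A1 \<or> A = A2"
proof -
  define P where "P = {(i, j). i < j \<and> j < r}"
  define B where "B = card P"
  have "P \<subseteq> {..<r} \<times> {..<r}" by (auto simp: P_def)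
  then have "finite P" by (rule finite_subset) simp
  then obtain pr where pr: "bij_betw pr {..<B} P"
    using ex_bij_betw_nat_finite by (metis B_def atLeast0LessThan)
  define blk where "blk = inv_into {..<B} pr"
  have blk: "blk p < B" "pr (blk p) = p" if "p \<in> P" for p
    using that bij_betwE[OF bij_betw_inv_into[OF pr]] bij_betw_inv_into_right[OF pr]
    by (auto simp: blk_def)
  have blk_pr: "blk (pr b) = b" if "b < B" for b
    using that bij_betw_inv_into_left[OF pr] by (simp add: blk_def)
  have pr_P: "fst (pr b) < snd (pr b)" "snd (pr b) < r" if "b < B" for b
  proof -
    have "pr b \<in> P" using bij_betwE[OF pr] that by simp
    then show "fst (pr b) < snd (pr b)" "snd (pr b) < r" by (auto simp: P_def)
  qed
  \<comment> \<open>Block b belongs to the pair \<open>pr b\<close>; its chords are toggled by the two variables of the pair and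
    by \<open>Inr b\<close>, which feasibility forces to be their exclusive or. The other index of chord t of
    variable i is t or t + 1, skipping i.\<close>
  define U :: "(nat + nat) set" where "U = Inl ` {..<r} \<union> Inr ` {..<B}"
  define q :: "nat + nat \<Rightarrow> nat" where "q = case_sum (\<lambda>_. r - 1) (\<lambda>_. 1)"
  define G :: "nat + nat \<Rightarrow> nat \<Rightarrow> nat" where
    "G u t = (case u of Inl i \<Rightarrow> if t < i then 6 * blk (t, i) + 1 else 6 * blk (i, t + 1)
              | Inr b \<Rightarrow> 6 * b + 2)" for u t
  define var :: "nat \<Rightarrow> nat + nat" where
    "var g = (if g mod 6 = 0 then Inl (fst (pr (g div 6)))
              else if g mod 6 = 1 then Inl (snd (pr (g div 6))) else Inr (g div 6))" for g
  define pos where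
    "pos g = (if g mod 6 = 0 then snd (pr (g div 6)) - 1
              else if g mod 6 = 1 then fst (pr (g div 6)) else 0)" for g
  interpret chain_system B U q G var pos
  proof
    show "finite U" by (simp add: U_def)
  next
    fix g assume g: "g < 6 * B" "g mod 6 < 3"
    define b where "b = g div 6"
    have b: "b < B" using g by (simp add: b_def less_6_mult_iff)
    have gb: "g = 6 * b + g mod 6" by (simp add: b_def)
    have blk': "blk (fst (pr b), snd (pr b)) = b" using blk_pr[OF b] by simp
    from g(2) consider "g mod 6 = 0" | "g mod 6 = 1" | "g mod 6 = 2" by linarith
    then show "var g \<in> U \<and> pos g < q (var g) \<and> G (var g) (pos g) = g"
    proof cases
      case 1
      then have "var g = Inl (fst (pr b))" "pos g = snd (pr b) - 1" "g = 6 * b"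
        using gb by (simp_all add: var_def pos_def b_def)
      then show ?thesis using pr_P[OF b] blk' by (auto simp: U_def q_def G_def)
    next
      case 2
      then have "var g = Inl (snd (pr b))" "pos g = fst (pr b)" "g = 6 * b + 1"
        using gb by (simp_all add: var_def pos_def b_def)
      then show ?thesis using pr_P[OF b] blk' by (auto simp: U_def q_def G_def)
    next
      case 3
      then have "var g = Inr b" "pos g = 0" "g = 6 * b + 2"
        using gb by (simp_all add: var_def pos_def b_def)
      then show ?thesis using b by (auto simp: U_def q_def G_def)
    qed
  next
    fix u t assume u: "u \<in> U" "t < q u"
    show "G u t < 6 * B \<and> G u t mod 6 < 3 \<and> var (G u t) = u \<and> pos (G u t) = t"
    proof (cases u)
      case (Inl i)
      then have i: "i < r" "t < r - 1" using u by (auto simp: U_def q_def)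
      show ?thesis
      proof (cases "t < i")
        case True
        then have "(t, i) \<in> P" using i by (simp add: P_def)
        with blk[of "(t, i)"] True Inl show ?thesis by (simp add: G_def var_def pos_def)
      next
        case False
        then have "(i, t + 1) \<in> P" using i by (auto simp: P_def)
        with blk[of "(i, t + 1)"] False Inl show ?thesis by (simp add: G_def var_def pos_def)
      qed
    next
      case (Inr b)
      then show ?thesis using u by (auto simp: G_def var_def pos_def U_def q_def)
    qed
  qed
  define Z :: "nat set \<Rightarrow> nat + nat \<Rightarrow> bool" where
    "Z x u = (case u of Inl i \<Rightarrow> i \<in> x | Inr b \<Rightarrow> (fst (pr b) \<in> x) \<noteq> (snd (pr b) \<in> x))" for x u
  have feasible_iff: "feasible z \<longleftrightarrow>
      (\<forall>b<B. z (Inr b) \<longleftrightarrow> z (Inl (fst (pr b))) \<noteq> z (Inl (snd (pr b))))" for z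
    by (simp add: feasible_def var_def)
  have feasible_Z: "feasible (Z x)" for x by (simp add: feasible_iff Z_def)
  have U_cases: "(\<exists>i<r. u = Inl i) \<or> (\<exists>b<B. u = Inr b)" if "u \<in> U" for u
    using that by (auto simp: U_def)
  \<comment> \<open>Here \<open>2 \<le> r\<close> is needed: every index must have another one to be
    paired with.\<close>
  have q_pos: "0 < q u" for u using assms by (simp add: q_def split: sum.split)
  \<comment> \<open>Feasibility determines the pair variables from the index variables.\<close>
  have eq_Z: "arcs w = arcs (Z x)" if w: "feasible w" "\<And>i. i < r \<Longrightarrow> w (Inl i) = Z x (Inl i)" for w x
  proof (rule arcs_cong)
    fix u assume "u \<in> U"
    then consider i where "i < r" "u = Inl i" | b where "b < B" "u = Inr b"
      using U_cases by blast
    then show "w u = Z x u"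
    proof cases
      case 2
      then have "fst (pr b) < r" "snd (pr b) < r" using pr_P[of b] by auto
      then show ?thesis using 2 w feasible_Z[of x] unfolding feasible_iff by simp
    qed (use w in simp)
  qed
  have inj: "inj_on (\<lambda>x. arcs (Z x)) (Pow {..<r})"
  proof (rule inj_onI)
    fix x y assume xy: "x \<in> Pow {..<r}" "y \<in> Pow {..<r}" "arcs (Z x) = arcs (Z y)"
    have "i \<in> x \<longleftrightarrow> i \<in> y" if "i < r" for i
      using arcs_subset_Un_imp[of "Z x" "Z y" "Z y" "Inl i"] xy(3) that q_pos[of "Inl i"]
      by (simp add: U_def Z_def)
    then show "x = y" using xy by blast
  qed
  show thesis
  proof (rule that[of V "Seg 0" "(\<lambda>x. arcs (Z x)) ` Pow {..<r}"])
    show "finite V" by (rule finite_V)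
    show "Seg 0 \<in> V" by simp
    show "card ((\<lambda>x. arcs (Z x)) ` Pow {..<r}) = 2 ^ r"
      using inj by (simp add: card_image card_Pow)
    show "ham_arcs V (Seg 0) A" if "A \<in> (\<lambda>x. arcs (Z x)) ` Pow {..<r}" for A
      using that ham_arcs_arcs[OF feasible_Z] by auto
    show "card V + 5 * r \<le> 4 * (r * r) + 1"
    proof -
      \<comment> \<open>Pair variables own a single chord and hence no item. The count is 6B + 1 =
        3r(r - 1) + 1 segments and r(r - 2) items.\<close>
      have "V \<subseteq> Seg ` {..6 * B} \<union> (\<lambda>(i, t). Item (Inl i) t) ` ({..<r} \<times> {..<r - 2})"
        (is "_ \<subseteq> ?R")
      proof
        fix v assume v: "v \<in> V"
        show "v \<in> ?R"
        proof (cases v)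
          case (Item u t)
          with v have "u \<in> U" "t + 1 < q u" by simp_all
          then obtain i where "u = Inl i" "i < r" "t < r - 2" by (auto simp: U_def q_def)
          with Item show ?thesis by (auto intro!: image_eqI[of _ _ "(i, t)"])
        qed (use v in simp)
      qed
      then have "card V \<le> card (Seg ` {..6 * B} \<union>
          (\<lambda>(i, t). Item (Inl i :: nat + nat) t) ` ({..<r} \<times> {..<r - 2}))"
        by (rule card_mono[rotated]) simp
      also have "\<dots> \<le> card (Seg ` {..6 * B} :: (nat + nat) node set)
          + card ((\<lambda>(i, t). Item (Inl i :: nat + nat) t) ` ({..<r} \<times> {..<r - 2}))"
        by (rule card_Un_le)
      also have "\<dots> \<le> card {..6 * B} + card ({..<r} \<times> {..<r - 2})"
        by (intro add_mono card_image_le) auto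
      finally have "card V \<le> 6 * B + 1 + r * (r - 2)" by simp
      moreover have "2 * B + r = r * r" unfolding B_def P_def by (rule card_less_pairs)
      moreover have "r * (r - 2) + 2 * r = r * r"
        using assms by (simp add: diff_mult_distrib2 mult.commute)
      ultimately show ?thesis by linarith
    qed
    show "A = A1 \<or> A = A2"
      if mem: "A1 \<in> (\<lambda>x. arcs (Z x)) ` Pow {..<r}" "A2 \<in> (\<lambda>x. arcs (Z x)) ` Pow {..<r}"
        and A: "ham_arcs V (Seg 0) A" "A \<subseteq> A1 \<union> A2" for A1 A2 A
    proof -
      obtain x y where xy: "A1 = arcs (Z x)" "A2 = arcs (Z y)" using mem by auto
      obtain w where w: "feasible w" "A = arcs w"
        and "\<forall>u\<in>U. 0 < q u \<longrightarrow> w u = Z x u \<or> w u = Z y u"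
        by (rule ham_arcs_between[OF A(1) A(2)[unfolded xy]])
      then have w_or: "w u = Z x u \<or> w u = Z y u" if "u \<in> U" for u using that q_pos by simp
      have "(\<forall>i<r. w (Inl i) = Z x (Inl i)) \<or> (\<forall>i<r. w (Inl i) = Z y (Inl i))"
      proof (rule ccontr)
        assume "\<not> ?thesis"
        then obtain i j where ij: "i < r" "w (Inl i) \<noteq> Z x (Inl i)" "j < r" "w (Inl j) \<noteq> Z y (Inl j)"
          by blast
        then have wi: "w (Inl i) = Z y (Inl i)" and wj: "w (Inl j) = Z x (Inl j)"
          using w_or[of "Inl i"] w_or[of "Inl j"] by (auto simp: U_def)
        then have "i \<noteq> j" using ij by auto
        then obtain p where p: "p \<in> P" "p = (i, j) \<or> p = (j, i)"
          using ij by (auto simp: P_def neq_iff)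
        define b where "b = blk p"
        have b: "b < B" "pr b = p" using blk[OF p(1)] by (auto simp: b_def)
        have "w (Inr b) = Z x (Inr b) \<or> w (Inr b) = Z y (Inr b)"
          using w_or b(1) by (simp add: U_def)
        moreover have "w (Inr b) \<longleftrightarrow> w (Inl (fst (pr b))) \<noteq> w (Inl (snd (pr b)))"
          using w(1) b(1) by (simp add: feasible_iff)
        \<comment> \<open>\<open>x\<close> and \<open>y\<close> differ at both \<open>i\<close> and
          \<open>j\<close>, so they give the pair variable the same value; but \<open>w\<close>
          agrees with \<open>y\<close> at \<open>i\<close> and with \<open>x\<close> at
          \<open>j\<close>, which gives the opposite value.\<close>
        ultimately show False using p(2) b(2) ij wi wj by (auto simp: Z_def)
      qed
      then show ?thesis using eq_Z[OF w(1)] w(2) xy by blast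
    qed
  qed
qed

section \<open>Choice of the number of variables\<close>

theorem theorem9:
  fixes n k :: nat and idx :: "nat set \<Rightarrow> 'd::finite"
  assumes "n > 2" and "1 < k" and "k < n"
    and "bij_betw idx (Kn_edges n) (UNIV :: 'd set)"
  shows "real (skel_clique_number (DCMST n k idx))
           \<ge> 2 powr ((sqrt (real (((n - 2) div (k - 1) - 1) div 2)) - 9) / 2)"
proof -
  define m where "m = ((n - 2) div (k - 1) - 1) div 2"
  define e where "e = (sqrt (real m) - 9) / 2"
  let ?\<omega> = "skel_clique_number (DCMST n k idx)"
  have "2 powr e \<le> real ?\<omega>"
  \<comment> \<open>For a nonpositive exponent the bound is at most 1, so a single vertex
    suffices.\<close>
  proof (cases "e \<le> 0")
    case True
    have "card {(\<lambda>v. {v, Suc v}) ` {..<n - 1}} \<le> ?\<omega>"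
    proof (rule card_le_skel_clique_numberI[OF assms(4)])
      show "dc_tree n k T" if "T \<in> {(\<lambda>v. {v, Suc v}) ` {..<n - 1}}" for T
        using that dc_tree_path[of k n] assms by simp
    qed auto
    moreover have "2 powr e \<le> 2 powr 0" using True by (intro powr_mono) auto
    ultimately show ?thesis by simp
  next
    case False
    define \<rho> where "\<rho> = nat \<lceil>e\<rceil>"
    \<comment> \<open>The exponent is rounded up, and the construction needs at least two
      variables.\<close>
    define r where "r = max 2 \<rho>"
    have e_le: "e \<le> real \<rho>" and \<rho>: "real \<rho> < e + 1" using False by (auto simp: \<rho>_def) linarith+
    \<comment> \<open>Rounding up costs less than 1 in the exponent, so 7 of the constant 9
      remains.\<close>
    have sq: "2 * real \<rho> + 7 < sqrt (real m)" using \<rho> by (simp add: e_def field_simps)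
    have "(2 * real \<rho> + 7)\<^sup>2 < (sqrt (real m))\<^sup>2"
      using sq by (intro power_strict_mono) auto
    then have "real ((2 * \<rho> + 7)\<^sup>2) < real m" by simp
    then have m: "(2 * \<rho> + 7)\<^sup>2 < m" by (simp only: of_nat_less_iff)
    have "2 \<le> r" by (simp add: r_def)
    then obtain V :: "(nat + nat) node set" and src \<A>
      where V: "finite V" "src \<in> V" "card V + 5 * r \<le> 4 * (r * r) + 1" "card \<A> = 2 ^ r"
        and ham: "\<And>A. A \<in> \<A> \<Longrightarrow> ham_arcs V src A"
        and between: "\<And>A1 A2 A. A1 \<in> \<A> \<Longrightarrow> A2 \<in> \<A> \<Longrightarrow> ham_arcs V src A \<Longrightarrow> A \<subseteq> A1 \<union> A2 \<Longrightarrow>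
          A = A1 \<or> A = A2"
      by (rule ex_ham_arcs_family) blast
    have "card V \<le> m"
    proof (cases "\<rho> \<le> 2")
      case True
      \<comment> \<open>Here \<open>r = 2\<close>, and the size bound reads 16 + 1 - 10 = 7.\<close>
      then have "card V \<le> 7" using V(3) by (simp add: r_def)
      moreover have "49 \<le> (2 * \<rho> + 7)\<^sup>2" by (simp add: power2_eq_square algebra_simps)
      ultimately show ?thesis using m by linarith
    next
      case False
      then have "card V \<le> 4 * (\<rho> * \<rho>) + 1" using V(3) by (simp add: r_def)
      then show ?thesis using m by (simp add: power2_eq_square algebra_simps)
    qed
    moreover have "2 * m \<le> (n - 2) div (k - 1)" unfolding m_def by simp
    ultimately have "2 * card V * (k - 1) \<le> (n - 2) div (k - 1) * (k - 1)"
      by (intro mult_right_mono) auto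
    also have "\<dots> \<le> n" using div_times_less_eq_dividend[of "n - 2" "k - 1"] by linarith
    finally have size: "2 * card V * (k - 1) \<le> n" .
    have "card \<A> \<le> ?\<omega>"
      by (rule card_le_clique_number_of_ham_arcs[OF assms(4) V(1,2) _ size ham])
        (use assms between in auto)
    have "2 powr e \<le> 2 powr real r" using e_le by (intro powr_mono) (auto simp: r_def)
    also have "\<dots> = real (card \<A>)" by (simp add: V(4) powr_realpow)
    also have "\<dots> \<le> real ?\<omega>" using \<open>card \<A> \<le> ?\<omega>\<close> by simp
    finally show ?thesis .
  qed
  then show ?thesis by (simp add: e_def m_def)
qed

end
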